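(* Let $\epsilon\in\{-1,1\}$ be fixed. A point transformation $\Phi$ connects two equations $\mathcal K^\epsilon_B$ and $\mathcal K^\epsilon_{\tilde B}$ from the class $\mathcal K^\epsilon$ if and only if its components are of the form \[ \tilde t=T(t),\quad\tilde x=X^1(t)x+X^0(t),\quad\tilde u=U^1(t,x)u+U^0(t,x), \] where $T$, $X^0$ and $X^1$ are arbitrary smooth functions of $t$ with $X^1\neq0$ and $T_t=(X^1)^2$, $U^1\ne0$, and $1/U^1$ and $U^0/U^1$ are arbitrary solutions of the equation $\mathcal K^\epsilon_B$. The relation between the arbitrary elements of the source and the target equations is given by \[ \Phi^*\tilde B=\frac1{X^1}\left(B-2\epsilon\frac{U^1_x}{U^1}\right)-\frac{X^1_tx+X^0_t}{(X^1)^2}. \]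
   Context: Everything is real, smooth and local; $f\neq0$ for a function means that it vanishes nowhere on its domain. The class $\mathcal K^\epsilon$ consists of the reduced Kolmogorov equations $\mathcal K^\epsilon_B$: $u_t=\epsilon u_{xx}+B(t,x)u_x$, where $B$ is an arbitrary smooth function of $(t,x)$. A point transformation is a local diffeomorphism of the space with coordinates $(t,x,u)$; it connects (maps) the source equation $\mathcal K^\epsilon_B$ to the target equation $\mathcal K^\epsilon_{\tilde B}$ if the pushforward of the former by it is the latter. $\Phi^*\tilde B$ denotes $\tilde B(T(t),X^1(t)x+X^0(t))$. *)

theory Defs
  imports "HOL-Analysis.Analysis"
begin

primrec times_differentiable_on ::
    "nat \<Rightarrow> 'a::real_normed_vector set \<Rightarrow> ('a \<Rightarrow> 'b::real_normed_vector) \<Rightarrow> bool" where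
  "times_differentiable_on 0 S f \<longleftrightarrow> continuous_on S f"
| "times_differentiable_on (Suc n) S f \<longleftrightarrow>
     (\<forall>x\<in>S. f differentiable (at x)) \<and>
     (\<forall>v. times_differentiable_on n S (\<lambda>x. frechet_derivative f (at x) v))"

text \<open>Derivatives are taken in the ambient space, so this is meant for open \<open>S\<close>.\<close>

definition smooth_on ::
    "'a::real_normed_vector set \<Rightarrow> ('a \<Rightarrow> 'b::real_normed_vector) \<Rightarrow> bool" where
  "smooth_on S f \<longleftrightarrow> (\<forall>n. times_differentiable_on n S f)"

text \<open>Points of the base are \<open>(t, x)\<close>, points of the total space are \<open>((t, x), u)\<close>. Thus
  \<open>fst ` \<Omega>\<close> is the projection of a set \<open>\<Omega>\<close> of the total space to the base.\<close>

type_synonym base = "real \<times> real"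
type_synonym total = "base \<times> real"

text \<open>A 2-jet is a tuple \<open>((t, x), u, u_t, u_x, u_tt, u_tx, u_xx)\<close>.\<close>

type_synonym jet = "base \<times> real \<times> real \<times> real \<times> real \<times> real \<times> real"

definition pd_t :: "(base \<Rightarrow> real) \<Rightarrow> base \<Rightarrow> real" where
  "pd_t f p = deriv (\<lambda>s. f (s, snd p)) (fst p)"

definition pd_x :: "(base \<Rightarrow> real) \<Rightarrow> base \<Rightarrow> real" where
  "pd_x f p = deriv (\<lambda>y. f (fst p, y)) (snd p)"

definition jet2 :: "(base \<Rightarrow> real) \<Rightarrow> base \<Rightarrow> jet" where
  "jet2 f p =
     (p, f p, pd_t f p, pd_x f p, pd_t (pd_t f) p, pd_t (pd_x f) p, pd_x (pd_x f) p)"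

definition kolmogorov :: "real \<Rightarrow> (base \<Rightarrow> real) \<Rightarrow> jet set" where
  "kolmogorov \<epsilon> B = {(p, u, ut, ux, utt, utx, uxx). ut = \<epsilon> * uxx + B p * ux}"

definition solves :: "real \<Rightarrow> (base \<Rightarrow> real) \<Rightarrow> base set \<Rightarrow> (base \<Rightarrow> real) \<Rightarrow> bool" where
  "solves \<epsilon> B D w \<longleftrightarrow> smooth_on D w \<and> (\<forall>p\<in>D. jet2 w p \<in> kolmogorov \<epsilon> B)"

definition point_transformation :: "total set \<Rightarrow> (total \<Rightarrow> total) \<Rightarrow> bool" where
  "point_transformation \<Omega> \<Phi> \<longleftrightarrow> open \<Omega> \<and>
     (\<forall>z\<in>\<Omega>. \<exists>N \<Psi>. open N \<and> z \<in> N \<and> N \<subseteq> \<Omega> \<and> smooth_on N \<Phi> \<and>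
        open (\<Phi> ` N) \<and> smooth_on (\<Phi> ` N) \<Psi> \<and> (\<forall>w\<in>N. \<Psi> (\<Phi> w) = w))"

definition graph_on :: "base set \<Rightarrow> (base \<Rightarrow> real) \<Rightarrow> total set" where
  "graph_on U f = (\<lambda>p. (p, f p)) ` U"

text \<open>The second prolongation of \<open>\<Phi>\<close>, as a relation on 2-jets: the jet of \<open>f\<close> at \<open>p\<close> goes to the
  jet of \<open>g\<close> at \<open>q\<close> if \<open>\<Phi>\<close> maps the graph of \<open>f\<close> near \<open>p\<close> onto the graph of \<open>g\<close>
  near \<open>q\<close>. The functions \<open>f\<close> and \<open>g\<close> are arbitrary, not just solutions. Jets of functions
  whose graphs are mapped to surfaces that are not graphs are outside the domain of this relation.\<close>

definition prolong2 :: "total set \<Rightarrow> (total \<Rightarrow> total) \<Rightarrow> (jet \<times> jet) set" where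
  "prolong2 \<Omega> \<Phi> = {(jet2 f p, jet2 g q) | f U p g V q.
     open U \<and> p \<in> U \<and> smooth_on U f \<and> graph_on U f \<subseteq> \<Omega> \<and>
     open V \<and> q \<in> V \<and> smooth_on V g \<and>
     \<Phi> ` graph_on U f = graph_on V g \<and> \<Phi> (p, f p) = (q, g q)}"

text \<open>The pushforward of the source equation is the target equation, the latter being restricted
  to the jets that are values of the prolongation.\<close>

definition connects ::
    "real \<Rightarrow> total set \<Rightarrow> (total \<Rightarrow> total) \<Rightarrow> (base \<Rightarrow> real) \<Rightarrow> (base \<Rightarrow> real) \<Rightarrow> bool" where
  "connects \<epsilon> \<Omega> \<Phi> B B' \<longleftrightarrow>
     prolong2 \<Omega> \<Phi> `` kolmogorov \<epsilon> B = kolmogorov \<epsilon> B' \<inter> Range (prolong2 \<Omega> \<Phi>)"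

definition has_components ::
    "real \<Rightarrow> (base \<Rightarrow> real) \<Rightarrow> total set \<Rightarrow> (total \<Rightarrow> total) \<Rightarrow> (real \<Rightarrow> real) \<Rightarrow> (real \<Rightarrow> real)
      \<Rightarrow> (real \<Rightarrow> real) \<Rightarrow> (base \<Rightarrow> real) \<Rightarrow> (base \<Rightarrow> real) \<Rightarrow> bool" where
  "has_components \<epsilon> B Q \<Phi> T X0 X1 U0 U1 \<longleftrightarrow>
     smooth_on (fst ` fst ` Q) T \<and> smooth_on (fst ` fst ` Q) X0 \<and> smooth_on (fst ` fst ` Q) X1 \<and>
     smooth_on (fst ` Q) U0 \<and> smooth_on (fst ` Q) U1 \<and>
     (\<forall>t x u. ((t, x), u) \<in> Q \<longrightarrow>
        \<Phi> ((t, x), u) = ((T t, X1 t * x + X0 t), U1 (t, x) * u + U0 (t, x))) \<and>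
     (\<forall>t\<in>fst ` fst ` Q. X1 t \<noteq> 0 \<and> deriv T t = (X1 t)\<^sup>2) \<and>
     (\<forall>p\<in>fst ` Q. U1 p \<noteq> 0) \<and>
     solves \<epsilon> B (fst ` Q) (\<lambda>p. 1 / U1 p) \<and>
     solves \<epsilon> B (fst ` Q) (\<lambda>p. U0 p / U1 p)"

end

theory Submission
  imports Defs
begin

text \<open>Write \<open>\<Phi> = ((T, X), U)\<close>, let the graph of \<open>f\<close> be mapped to that of \<open>g\<close>, and compare
  \<open>g\<close> with \<open>U\<close> along the image of a line through \<open>(t, x)\<close>. In the direction \<open>(- D_x T, D_t T)\<close> the
  \<open>T\<close>-component of the image has zero velocity, so the second derivative along the line involves
  \<open>g_xx\<close> but neither \<open>g_tt\<close> nor \<open>g_tx\<close>; the target equation becomes a relation between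
  \<open>\<Phi>\<close> and the 2-jet of \<open>f\<close>. Quadratic polynomials \<open>f\<close> realise all jets of the source equation:
  varying \<open>f_tt\<close> gives \<open>T_x = T_u = 0\<close>, varying \<open>f_xx\<close> gives \<open>X_u = 0\<close> and \<open>X_x\<^sup>2 = T_t\<close>, and the
  \<open>f_x\<^sup>2\<close>-coefficient gives \<open>U_uu = 0\<close>.

  Once \<open>\<Phi>\<close> has this affine form, \<open>h = U1 f + U0\<close> is the pull-back of \<open>g\<close>, and \<open>g\<close> satisfies the
  target equation iff \<open>h\<close> satisfies an equation with a modified drift \<open>c\<close>. Comparing with
  \<open>f = h / U1 - U0 / U1\<close> yields both directions.\<close>

subsection \<open>Calculus of smooth functions\<close>

text \<open>The prolongation relates jets only through graphs that are mapped to graphs, so a test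
  function f is usable only where D_t T D_x X - D_x T D_t X is nonzero, and at the start nothing is
  known about the shape of \<Phi>. This determinant is affine in (f_t, f_x) and not identically
  zero, which leaves enough jets to test with.

  In every comparison the second derivatives of f come with the factor U_u - g_t T_u - g_x X_u. If
  it vanished, the covector (g_t, g_x, -1) would annihilate the differential of \<Phi>; hence it can
  be cancelled. Now f_tt contributes through (D_x T)^2, which must vanish, while f_xx acts twice: on
  g_xx through the second derivative along the line, and on g_t because the source equation makes
  f_t follow f_xx. Equating the two effects gives X_x^2 = T_t.

  Vanishing derivatives mean independence of a variable only along connected fibres, which is why
  everything is done on a convex Q.\<close>

lemma times_differentiable_on_cong:
  assumes "open S" "\<And>x. x \<in> S \<Longrightarrow> f x = g x"
  shows "times_differentiable_on n S f \<longleftrightarrow> times_differentiable_on n S g"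
  using assms(2)
proof (induction n arbitrary: f g)
  case 0
  then show ?case by (simp cong: continuous_on_cong)
next
  case (Suc n)
  have ev: "eventually (\<lambda>y. f y = g y) (at x)" if "x \<in> S" for x
    using eventually_at_in_open'[OF assms(1) that] by eventually_elim (rule Suc.prems)
  have der: "(f has_derivative D) (at x) \<longleftrightarrow> (g has_derivative D) (at x)" if "x \<in> S" for x D
    using that Suc.prems assms(1) by (metis has_derivative_transform_within_open)
  have "f differentiable at x \<longleftrightarrow> g differentiable at x" if "x \<in> S" for x
    using der[OF that] by (simp add: differentiable_def)
  moreover have "frechet_derivative f (at x) = frechet_derivative g (at x)" if "x \<in> S" for x
    using der[OF that] by (simp add: frechet_derivative_def)
  ultimately show ?case
    using Suc.IH[of "\<lambda>x. frechet_derivative f (at x) v" "\<lambda>x. frechet_derivative g (at x) v" for v]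
    by simp
qed

text \<open>The recursion speaks of \<open>frechet_derivative\<close>, a choice operator. Uniqueness
  of derivatives lets an explicit formula \<open>f'\<close> replace it; the product, chain and
  inverse rules go through this lemma.\<close>

lemma times_differentiable_on_SucI:
  assumes "open S" "\<And>x. x \<in> S \<Longrightarrow> (f has_derivative f' x) (at x)"
    and "\<And>v. times_differentiable_on n S (\<lambda>x. f' x v)"
  shows "times_differentiable_on (Suc n) S f"
proof -
  have "frechet_derivative f (at x) = f' x" if "x \<in> S" for x
    using frechet_derivative_at[OF assms(2)[OF that]] by simp
  then have "times_differentiable_on n S (\<lambda>x. frechet_derivative f (at x) v)" for v
    using times_differentiable_on_cong[OF assms(1), of "\<lambda>x. frechet_derivative f (at x) v" "\<lambda>x. f' x v"]
      assms(3)[of v] by simp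
  moreover have "\<forall>x\<in>S. f differentiable at x"
    using assms(2) differentiable_def by blast
  ultimately show ?thesis by simp
qed

lemma times_differentiable_on_Suc_has_derivative:
  "times_differentiable_on (Suc n) S f \<Longrightarrow> x \<in> S \<Longrightarrow>
    (f has_derivative frechet_derivative f (at x)) (at x)"
  by (simp add: frechet_derivative_works)

lemma times_differentiable_on_Suc_direction:
  "times_differentiable_on (Suc n) S f \<Longrightarrow>
    times_differentiable_on n S (\<lambda>x. frechet_derivative f (at x) v)"
  by simp

lemma times_differentiable_on_less:
  "times_differentiable_on (Suc n) S f \<Longrightarrow> times_differentiable_on n S f"
proof (induction n arbitrary: f)
  case 0
  then show ?case
    by (simp add: continuous_at_imp_continuous_on differentiable_imp_continuous_within)
next
  case (Suc n)
  have "times_differentiable_on n S (\<lambda>x. frechet_derivative f (at x) v)" for v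
    using Suc.prems by (intro Suc.IH) (simp only: times_differentiable_on.simps(2), blast)
  then show ?case
    using Suc.prems by simp
qed

lemma times_differentiable_on_subset:
  "times_differentiable_on n T f \<Longrightarrow> S \<subseteq> T \<Longrightarrow> times_differentiable_on n S f"
  by (induction n arbitrary: f) (auto intro: continuous_on_subset)

lemma times_differentiable_on_local:
  assumes "\<And>x. x \<in> S \<Longrightarrow> \<exists>N. open N \<and> x \<in> N \<and> times_differentiable_on n N f"
  shows "times_differentiable_on n S f"
  using assms
proof (induction n arbitrary: f)
  case 0
  have "isCont f x" if x: "x \<in> S" for x
  proof -
    obtain N where "open N" "x \<in> N" "continuous_on N f"
      using 0[OF x] by auto
    then show ?thesis
      using continuous_on_eq_continuous_at by blast
  qed
  then show ?case
    by (simp add: continuous_at_imp_continuous_on)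
next
  case (Suc n)
  have "times_differentiable_on n S (\<lambda>x. frechet_derivative f (at x) v)" for v
    using Suc.prems by (intro Suc.IH) (simp, blast)
  moreover have "\<forall>x\<in>S. f differentiable at x"
    using Suc.prems by force
  ultimately show ?case
    by simp
qed

lemma times_differentiable_on_const: "times_differentiable_on n S (\<lambda>x. c)"
  by (induction n arbitrary: c) (auto simp: frechet_derivative_const)

text \<open>Sums, projections and negation all come from this: a sum is a pair followed by the
  bounded linear map (x, y) -> x + y.\<close>

lemma times_differentiable_on_linear:
  assumes L: "bounded_linear L" and S: "open S"
  shows "times_differentiable_on n S f \<Longrightarrow> times_differentiable_on n S (\<lambda>x. L (f x))"
proof (induction n arbitrary: f)
  case 0
  then show ?case
    using bounded_linear.continuous_on[OF L] by auto
next
  case (Suc n)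
  show ?case
    using bounded_linear.has_derivative[OF L times_differentiable_on_Suc_has_derivative[OF Suc.prems]]
    by (rule times_differentiable_on_SucI[OF S])
      (auto intro: Suc.IH times_differentiable_on_Suc_direction[OF Suc.prems])
qed

lemma times_differentiable_on_Pair:
  assumes S: "open S"
  shows "times_differentiable_on n S f \<Longrightarrow> times_differentiable_on n S g \<Longrightarrow>
    times_differentiable_on n S (\<lambda>x. (f x, g x))"
proof (induction n arbitrary: f g)
  case 0
  then show ?case
    by (auto intro: continuous_on_Pair)
next
  case (Suc n)
  show ?case
    using has_derivative_Pair[OF times_differentiable_on_Suc_has_derivative[OF Suc.prems(1)]
        times_differentiable_on_Suc_has_derivative[OF Suc.prems(2)]]
    by (rule times_differentiable_on_SucI[OF S])
      (auto intro!: Suc.IH times_differentiable_on_Suc_direction[OF Suc.prems(1)]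
        times_differentiable_on_Suc_direction[OF Suc.prems(2)])
qed

lemma times_differentiable_on_add:
  assumes "open S" "times_differentiable_on n S f" "times_differentiable_on n S g"
  shows "times_differentiable_on n S (\<lambda>x. f x + g x)"
  using times_differentiable_on_linear[OF bounded_linear_add[OF bounded_linear_fst bounded_linear_snd]
      assms(1) times_differentiable_on_Pair[OF assms]]
  by simp

lemma times_differentiable_on_scaleR:
  assumes S: "open S"
  shows "times_differentiable_on n S f \<Longrightarrow> times_differentiable_on n S g \<Longrightarrow>
    times_differentiable_on n S (\<lambda>x. f x *\<^sub>R g x)"
proof (induction n arbitrary: f g)
  case 0
  then show ?case
    by (auto intro: continuous_on_scaleR)
next
  case (Suc n)
  show ?case
    using has_derivative_scaleR[OF times_differentiable_on_Suc_has_derivative[OF Suc.prems(1)]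
        times_differentiable_on_Suc_has_derivative[OF Suc.prems(2)]]
    by (rule times_differentiable_on_SucI[OF S])
      (auto intro!: Suc.IH times_differentiable_on_add[OF S]
        times_differentiable_on_Suc_direction[OF Suc.prems(1)]
        times_differentiable_on_Suc_direction[OF Suc.prems(2)]
        times_differentiable_on_less[OF Suc.prems(1)] times_differentiable_on_less[OF Suc.prems(2)])
qed

lemma times_differentiable_on_sum:
  assumes "open S" "\<And>i. i \<in> I \<Longrightarrow> times_differentiable_on n S (f i)"
  shows "times_differentiable_on n S (\<lambda>x. \<Sum>i\<in>I. f i x)"
  using assms(2)
  by (induction I rule: infinite_finite_induct)
    (auto intro: times_differentiable_on_const times_differentiable_on_add[OF assms(1)])

text \<open>The derivative - f^(-2) Df contains the inverse of the same f, so the induction runs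
  over the order with f fixed; written as iterated scalar products, it falls under the product
  rule.\<close>

lemma times_differentiable_on_inverse:
  fixes f :: "'a::real_normed_vector \<Rightarrow> real"
  assumes S: "open S" and nz: "\<And>x. x \<in> S \<Longrightarrow> f x \<noteq> 0"
  shows "times_differentiable_on n S f \<Longrightarrow> times_differentiable_on n S (\<lambda>x. inverse (f x))"
proof (induction n)
  case 0
  then show ?case
    using nz by (auto intro: continuous_on_inverse)
next
  case (Suc n)
  note inv = Suc.IH[OF times_differentiable_on_less[OF Suc.prems]]
  have "((\<lambda>x. inverse (f x)) has_derivative
      (\<lambda>v. inverse (f x) *\<^sub>R inverse (f x) *\<^sub>R (- 1) *\<^sub>R frechet_derivative f (at x) v)) (at x)"
    if "x \<in> S" for x
    using Deriv.has_derivative_inverse[OF nz[OF that]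
        times_differentiable_on_Suc_has_derivative[OF Suc.prems that]]
    by (simp add: mult_ac)
  then show ?case
  proof (rule times_differentiable_on_SucI[OF S])
    show "times_differentiable_on n S
        (\<lambda>x. inverse (f x) *\<^sub>R inverse (f x) *\<^sub>R (- 1) *\<^sub>R frechet_derivative f (at x) v)" for v
      by (intro times_differentiable_on_scaleR[OF S] inv times_differentiable_on_const
        times_differentiable_on_Suc_direction[OF Suc.prems])
  qed
qed

text \<open>The chain rule feeds the moving direction Dg(x) v into Df, whereas the definition
  controls Df in fixed directions only. Expanding the direction in \<open>Basis\<close> gives a
  finite sum of products; this is where the Euclidean type of the middle space enters.\<close>

lemma times_differentiable_on_compose:
  fixes g :: "'a::real_normed_vector \<Rightarrow> 'b::euclidean_space"
    and f :: "'b \<Rightarrow> 'c::real_normed_vector"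
  assumes S: "open S" and sub: "g ` S \<subseteq> T"
  shows "times_differentiable_on n T f \<Longrightarrow> times_differentiable_on n S g \<Longrightarrow>
    times_differentiable_on n S (\<lambda>x. f (g x))"
proof (induction n arbitrary: f)
  case 0
  then show ?case
    using sub by (auto intro: continuous_on_compose2)
next
  case (Suc n)
  note f' = times_differentiable_on_Suc_has_derivative[OF Suc.prems(1)]
  note g' = times_differentiable_on_Suc_has_derivative[OF Suc.prems(2)]
  have "((\<lambda>x. f (g x)) has_derivative (\<lambda>v. \<Sum>i\<in>Basis. (frechet_derivative g (at x) v \<bullet> i) *\<^sub>R
      frechet_derivative f (at (g x)) i)) (at x)" if "x \<in> S" for x
  proof -
    have gx: "g x \<in> T" using that sub by auto
    have lin: "linear (frechet_derivative f (at (g x)))"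
      using f'[OF gx] has_derivative_linear by blast
    have "(\<Sum>i\<in>Basis. (w \<bullet> i) *\<^sub>R frechet_derivative f (at (g x)) i) =
        frechet_derivative f (at (g x)) (\<Sum>i\<in>Basis. (w \<bullet> i) *\<^sub>R i)" for w
      by (simp only: linear_sum[OF lin] linear_scale[OF lin])
    then have "(\<Sum>i\<in>Basis. (w \<bullet> i) *\<^sub>R frechet_derivative f (at (g x)) i) =
        frechet_derivative f (at (g x)) w" for w
      by (simp only: euclidean_representation)
    then show ?thesis
      using has_derivative_compose[OF g'[OF that] f'[OF gx]] by simp
  qed
  then show ?case
  proof (rule times_differentiable_on_SucI[OF S])
    fix v
    have "times_differentiable_on n S (\<lambda>x. frechet_derivative g (at x) v \<bullet> i)" for i
      by (rule times_differentiable_on_linear[OF bounded_linear_inner_left S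
            times_differentiable_on_Suc_direction[OF Suc.prems(2)]])
    moreover have "times_differentiable_on n S (\<lambda>x. frechet_derivative f (at (g x)) i)" for i
      by (rule Suc.IH[OF times_differentiable_on_Suc_direction[OF Suc.prems(1)]
            times_differentiable_on_less[OF Suc.prems(2)]])
    ultimately show "times_differentiable_on n S (\<lambda>x. \<Sum>i\<in>Basis.
        (frechet_derivative g (at x) v \<bullet> i) *\<^sub>R frechet_derivative f (at (g x)) i)"
      by (intro times_differentiable_on_sum times_differentiable_on_scaleR S)
  qed
qed

lemma smooth_on_cong:
  "open S \<Longrightarrow> (\<And>x. x \<in> S \<Longrightarrow> f x = g x) \<Longrightarrow> smooth_on S f \<longleftrightarrow> smooth_on S g"
  using times_differentiable_on_cong[of S f g] by (simp add: smooth_on_def)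

lemma smooth_on_subset: "smooth_on T f \<Longrightarrow> S \<subseteq> T \<Longrightarrow> smooth_on S f"
  unfolding smooth_on_def by (blast intro: times_differentiable_on_subset)

lemma smooth_on_local:
  "(\<And>x. x \<in> S \<Longrightarrow> \<exists>N. open N \<and> x \<in> N \<and> smooth_on N f) \<Longrightarrow> smooth_on S f"
  unfolding smooth_on_def by (meson times_differentiable_on_local)

lemma smooth_on_has_derivative:
  "smooth_on S f \<Longrightarrow> x \<in> S \<Longrightarrow> (f has_derivative frechet_derivative f (at x)) (at x)"
  unfolding smooth_on_def by (blast intro: times_differentiable_on_Suc_has_derivative)

lemma smooth_on_direction:
  "smooth_on S f \<Longrightarrow> smooth_on S (\<lambda>x. frechet_derivative f (at x) v)"
  unfolding smooth_on_def by (blast intro: times_differentiable_on_Suc_direction)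

lemma smooth_on_imp_continuous_on: "smooth_on S f \<Longrightarrow> continuous_on S f"
  unfolding smooth_on_def by (metis times_differentiable_on.simps(1))

lemma smooth_on_linear:
  "bounded_linear L \<Longrightarrow> open S \<Longrightarrow> smooth_on S f \<Longrightarrow> smooth_on S (\<lambda>x. L (f x))"
  by (simp add: smooth_on_def times_differentiable_on_linear)

lemma smooth_on_const: "smooth_on S (\<lambda>x. c)"
  by (simp add: smooth_on_def times_differentiable_on_const)

lemma smooth_on_Pair:
  "open S \<Longrightarrow> smooth_on S f \<Longrightarrow> smooth_on S g \<Longrightarrow> smooth_on S (\<lambda>x. (f x, g x))"
  by (simp add: smooth_on_def times_differentiable_on_Pair)

lemma smooth_on_add:
  "open S \<Longrightarrow> smooth_on S f \<Longrightarrow> smooth_on S g \<Longrightarrow> smooth_on S (\<lambda>x. f x + g x)"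
  by (simp add: smooth_on_def times_differentiable_on_add)

lemma smooth_on_mult:
  fixes f g :: "'a::real_normed_vector \<Rightarrow> real"
  shows "open S \<Longrightarrow> smooth_on S f \<Longrightarrow> smooth_on S g \<Longrightarrow> smooth_on S (\<lambda>x. f x * g x)"
  using times_differentiable_on_scaleR[of S _ f g] by (simp add: smooth_on_def)

lemma smooth_on_minus: "open S \<Longrightarrow> smooth_on S f \<Longrightarrow> smooth_on S (\<lambda>x. - f x)"
  by (rule smooth_on_linear[OF bounded_linear_minus[OF bounded_linear_ident]])

lemma smooth_on_diff:
  "open S \<Longrightarrow> smooth_on S f \<Longrightarrow> smooth_on S g \<Longrightarrow> smooth_on S (\<lambda>x. f x - g x)"
  using smooth_on_add[OF _ _ smooth_on_minus, of S f g] by simp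

lemma smooth_on_divide:
  fixes f g :: "'a::real_normed_vector \<Rightarrow> real"
  shows "open S \<Longrightarrow> smooth_on S f \<Longrightarrow> smooth_on S g \<Longrightarrow> (\<And>x. x \<in> S \<Longrightarrow> g x \<noteq> 0) \<Longrightarrow>
    smooth_on S (\<lambda>x. f x / g x)"
  unfolding divide_inverse
  by (intro smooth_on_mult) (auto simp: smooth_on_def times_differentiable_on_inverse)

lemma smooth_on_power:
  fixes f :: "'a::real_normed_vector \<Rightarrow> real"
  shows "open S \<Longrightarrow> smooth_on S f \<Longrightarrow> smooth_on S (\<lambda>x. f x ^ n)"
  by (induction n) (auto intro: smooth_on_const smooth_on_mult)

lemma smooth_on_ident: "smooth_on S (\<lambda>x. x)"
proof -
  have "times_differentiable_on n UNIV (\<lambda>x::'a. x)" for n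
    by (induction n) (auto simp: times_differentiable_on_const frechet_derivative_ident)
  then show ?thesis
    using smooth_on_subset[of UNIV "\<lambda>x::'a. x" S] by (simp add: smooth_on_def)
qed

lemma smooth_on_fst: "open S \<Longrightarrow> smooth_on S f \<Longrightarrow> smooth_on S (\<lambda>x. fst (f x))"
  and smooth_on_snd: "open S \<Longrightarrow> smooth_on S f \<Longrightarrow> smooth_on S (\<lambda>x. snd (f x))"
  by (rule smooth_on_linear[OF bounded_linear_fst] smooth_on_linear[OF bounded_linear_snd]; assumption)+

lemma smooth_on_compose:
  fixes g :: "'a::real_normed_vector \<Rightarrow> 'b::euclidean_space"
    and f :: "'b \<Rightarrow> 'c::real_normed_vector"
  shows "smooth_on T f \<Longrightarrow> open S \<Longrightarrow> smooth_on S g \<Longrightarrow> g ` S \<subseteq> T \<Longrightarrow>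
    smooth_on S (\<lambda>x. f (g x))"
  unfolding smooth_on_def by (metis times_differentiable_on_compose)

lemmas smooth_intros = smooth_on_const smooth_on_ident smooth_on_Pair smooth_on_add smooth_on_diff
  smooth_on_minus smooth_on_mult smooth_on_divide smooth_on_power smooth_on_fst smooth_on_snd
  smooth_on_direction

subsection \<open>Smooth inverses in the plane and partial derivatives\<close>

text \<open>The inverse function theorem yields only a differentiable inverse G. Its derivative at y
  is the inverse Jacobian matrix taken at G y, so each order of regularity of G yields the next
  one.\<close>

lemma smooth_inverse_plane:
  fixes F :: "base \<Rightarrow> base"
  defines "J \<equiv> \<lambda>x. fst (frechet_derivative F (at x) (1, 0)) * snd (frechet_derivative F (at x) (0, 1))
      - fst (frechet_derivative F (at x) (0, 1)) * snd (frechet_derivative F (at x) (1, 0))"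
  assumes S: "open S" and F: "smooth_on S F" and p: "p \<in> S" "J p \<noteq> 0"
  obtains U G where "open U" "p \<in> U" "U \<subseteq> S" "open (F ` U)" "smooth_on (F ` U) G"
    "\<And>x. x \<in> U \<Longrightarrow> G (F x) = x"
proof -
  let ?D = "\<lambda>x. frechet_derivative F (at x)"
  define S0 where "S0 = {x \<in> S. J x \<noteq> 0}"
  have smJ: "smooth_on S J"
    unfolding J_def by (intro smooth_intros S F)
  have S0: "open S0"
  proof -
    have "S0 = S \<inter> J -` (- {0})" by (auto simp: S0_def)
    then show ?thesis
      using continuous_open_preimage[OF smooth_on_imp_continuous_on[OF smJ] S, of "- {0}"] by auto
  qed
  have F0: "smooth_on S0 F"
    using F by (rule smooth_on_subset) (auto simp: S0_def)
  have der: "(F has_derivative ?D x) (at x)" if "x \<in> S0" for x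
    using smooth_on_has_derivative[OF F0 that] .
  have expand: "?D x v = fst v *\<^sub>R ?D x (1, 0) + snd v *\<^sub>R ?D x (0, 1)" if "x \<in> S0" for x v
  proof -
    have lin: "linear (?D x)" using has_derivative_linear[OF der[OF that]] .
    have "?D x v = ?D x (fst v *\<^sub>R (1, 0) + snd v *\<^sub>R (0, 1))"
      by simp
    then show ?thesis
      by (simp only: linear_add[OF lin] linear_scale[OF lin])
  qed
  \<comment> \<open>Cramer's rule for the Jacobian matrix; the explicit quotient makes
    \<open>K v\<close> visibly smooth where \<open>J\<close> does not vanish.\<close>
  define K where "K v x =
      ((fst v * snd (?D x (0, 1)) - snd v * fst (?D x (0, 1))) / J x,
       (snd v * fst (?D x (1, 0)) - fst v * snd (?D x (1, 0))) / J x)" for v x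
  have DK: "?D x (K v x) = v" and KD: "K (?D x v) x = v" if x: "x \<in> S0" for x v
  proof -
    have "J x \<noteq> 0" using x by (simp add: S0_def)
    then show "?D x (K v x) = v"
      unfolding expand[OF x, of "K v x"]
      by (simp add: K_def prod_eq_iff divide_simps) (simp add: J_def algebra_simps)
    show "K (?D x v) x = v"
      unfolding K_def using \<open>J x \<noteq> 0\<close>
      by (simp add: expand[OF x, of v] prod_eq_iff divide_simps) (simp add: J_def algebra_simps)
  qed
  have smK: "smooth_on S0 (K v)" for v
  proof -
    have "smooth_on S0 J" using smJ by (rule smooth_on_subset) (auto simp: S0_def)
    then show ?thesis
      unfolding K_def by (intro smooth_intros S0 F0) (auto simp: S0_def)
  qed
  have bl: "bounded_linear (?D x)" if "x \<in> S0" for x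
    using der[OF that] by (rule has_derivative_bounded_linear)
  define F' where "F' x = Blinfun (?D x)" for x
  have F': "blinfun_apply (F' x) = ?D x" if "x \<in> S0" for x
    using bl[OF that] by (simp add: F'_def bounded_linear_Blinfun_apply)
  have pS0: "p \<in> S0" using p by (simp add: S0_def)
  have Klin: "bounded_linear (\<lambda>v. K v p)"
    unfolding K_def linear_conv_bounded_linear[symmetric]
    by (rule linearI) (auto simp: algebra_simps add_divide_distrib diff_divide_distrib)
  obtain U V G g' where UV: "open U" "U \<subseteq> S0" "p \<in> U" "open V" "homeomorphism U V F G"
    and G': "\<And>y. y \<in> V \<Longrightarrow> (G has_derivative (g' y)) (at y)"
    and g': "\<And>y. y \<in> V \<Longrightarrow> g' y = inv (blinfun_apply (F'(G y)))"
    "\<And>y. y \<in> V \<Longrightarrow> bij (blinfun_apply (F'(G y)))"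
  proof (rule inverse_function_theorem[OF S0])
    show "(F has_derivative blinfun_apply (F' x)) (at x)" if "x \<in> S0" for x
      using der[OF that] F'[OF that] by simp
    have "continuous_on S0 (\<lambda>x. blinfun_apply (F' x) i)" for i
      using smooth_on_imp_continuous_on[OF smooth_on_direction[OF F0, of i]] F'
      by (simp cong: continuous_on_cong)
    then show "continuous_on S0 F'"
      by (rule continuous_on_blinfun_componentwise)
    show "p \<in> S0" by (rule pS0)
    show "Blinfun (\<lambda>v. K v p) o\<^sub>L F' p = id_blinfun"
      using KD[OF pS0] F'[OF pS0] by (auto intro!: blinfun_eqI simp: bounded_linear_Blinfun_apply[OF Klin])
  qed (blast intro: that)
  have GV: "G y \<in> S0" if "y \<in> V" for y
    using UV that by (auto simp: homeomorphism_def)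
  have GK: "(G has_derivative (\<lambda>v. K v (G y))) (at y)" if "y \<in> V" for y
  proof -
    have "g' y v = K v (G y)" for v
      unfolding g'(1)[OF that]
      using g'(2)[OF that] DK[OF GV[OF that]] F'[OF GV[OF that]] by (metis bij_inv_eq_iff)
    then show ?thesis
      using G'[OF that] by (metis (no_types, lifting) ext)
  qed
  have "times_differentiable_on n V G" for n
  proof (induction n)
    case 0
    then show ?case using UV(5) by (simp add: homeomorphism_def)
  next
    case (Suc n)
    show ?case
    proof (rule times_differentiable_on_SucI[OF UV(4) GK])
      have "times_differentiable_on n S0 (K v)" for v
        using smK by (simp add: smooth_on_def)
      then show "times_differentiable_on n V (\<lambda>y. K v (G y))" for v
        using times_differentiable_on_compose[OF UV(4) _ _ Suc, of S0] GV by blast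
    qed
  qed
  then have "smooth_on V G" by (simp add: smooth_on_def)
  moreover have "F ` U = V" "\<And>x. x \<in> U \<Longrightarrow> G (F x) = x"
    using UV(5) by (auto simp: homeomorphism_def)
  moreover have "U \<subseteq> S" using UV(2) by (auto simp: S0_def)
  ultimately show ?thesis
    using that UV(1,3,4) by metis
qed

section \<open>Point transformations: regularity and differential\<close>

lemma point_transformation_smooth:
  assumes "point_transformation \<Omega> \<Phi>"
  shows "open \<Omega>" "smooth_on \<Omega> \<Phi>"
proof -
  show "open \<Omega>" using assms by (simp add: point_transformation_def)
  show "smooth_on \<Omega> \<Phi>"
    by (rule smooth_on_local) (use assms in \<open>unfold point_transformation_def, blast\<close>)
qed

text \<open>Differentiate \<Phi> (\<Psi> y) = y on the open image of N.\<close>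

lemma point_transformation_surj:
  assumes pt: "point_transformation \<Omega> \<Phi>" and z: "z \<in> \<Omega>"
  shows "surj (frechet_derivative \<Phi> (at z))"
proof -
  obtain N \<Psi> where N: "open N" "z \<in> N" "open (\<Phi> ` N)" "smooth_on N \<Phi>"
    "smooth_on (\<Phi> ` N) \<Psi>" "\<forall>w\<in>N. \<Psi> (\<Phi> w) = w"
    using assms unfolding point_transformation_def by blast
  have \<Phi>': "(\<Phi> has_derivative frechet_derivative \<Phi> (at z)) (at (\<Psi> (\<Phi> z)))"
    using smooth_on_has_derivative[OF N(4,2)] N(2,6) by simp
  have \<Psi>': "(\<Psi> has_derivative frechet_derivative \<Psi> (at (\<Phi> z))) (at (\<Phi> z))"
    using smooth_on_has_derivative[OF N(5)] N(2) by simp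
  have "((\<lambda>y. \<Phi> (\<Psi> y)) has_derivative
      (\<lambda>v. frechet_derivative \<Phi> (at z) (frechet_derivative \<Psi> (at (\<Phi> z)) v))) (at (\<Phi> z))"
    by (rule has_derivative_compose[OF \<Psi>' \<Phi>'])
  moreover have "((\<lambda>y. \<Phi> (\<Psi> y)) has_derivative (\<lambda>v. v)) (at (\<Phi> z))"
    using N(2,3,6) by (intro has_derivative_transform_within_open[OF has_derivative_ident N(3)]) auto
  ultimately have "(\<lambda>v. frechet_derivative \<Phi> (at z) (frechet_derivative \<Psi> (at (\<Phi> z)) v)) = (\<lambda>v. v)"
    by (rule has_derivative_unique)
  then show ?thesis
    by (metis surjI)
qed

section \<open>Partial derivatives on the base and on the total space\<close>

lemma has_derivative_pd:
  assumes "(w has_derivative D) (at (t, x))"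
  shows "((\<lambda>s. w (s, x)) has_real_derivative D (1, 0)) (at t)"
    and "((\<lambda>y. w (t, y)) has_real_derivative D (0, 1)) (at x)"
    and "pd_t w (t, x) = D (1, 0)" "pd_x w (t, x) = D (0, 1)"
proof -
  have lin: "linear D"
    using assms by (rule has_derivative_linear)
  have "((\<lambda>s. w (s, x)) has_derivative (\<lambda>h. D (h, 0))) (at t)"
    by (rule has_derivative_compose[OF has_derivative_Pair[OF has_derivative_ident has_derivative_const] assms])
  moreover have "h * D (1, 0) = D (h, 0)" for h
    using linear_scale[OF lin, of h "(1, 0)"] by simp
  ultimately show 1: "((\<lambda>s. w (s, x)) has_real_derivative D (1, 0)) (at t)"
    by (rule has_derivative_imp_has_field_derivative)
  have "((\<lambda>y. w (t, y)) has_derivative (\<lambda>h. D (0, h))) (at x)"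
    by (rule has_derivative_compose[OF has_derivative_Pair[OF has_derivative_const has_derivative_ident] assms])
  moreover have "h * D (0, 1) = D (0, h)" for h
    using linear_scale[OF lin, of h "(0, 1)"] by simp
  ultimately show 2: "((\<lambda>y. w (t, y)) has_real_derivative D (0, 1)) (at x)"
    by (rule has_derivative_imp_has_field_derivative)
  show "pd_t w (t, x) = D (1, 0)" "pd_x w (t, x) = D (0, 1)"
    using DERIV_imp_deriv[OF 1] DERIV_imp_deriv[OF 2] by (simp_all add: pd_t_def pd_x_def)
qed

lemma smooth_on_pd_eq:
  assumes "smooth_on S w" "p \<in> S"
  shows "pd_t w p = frechet_derivative w (at p) (1, 0)" "pd_x w p = frechet_derivative w (at p) (0, 1)"
  using has_derivative_pd(3,4)[of w _ "fst p" "snd p"] smooth_on_has_derivative[OF assms] by simp_all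

lemma smooth_on_pd:
  assumes "open S" "smooth_on S w"
  shows "smooth_on S (pd_t w)" "smooth_on S (pd_x w)"
  by (rule iffD2[OF smooth_on_cong smooth_on_direction[OF assms(2)]],
      rule assms(1), erule smooth_on_pd_eq[OF assms(2)])+

lemma smooth_on_pd_chain:
  assumes w: "smooth_on S w" "(P s, X s) \<in> S"
    and P: "(P has_real_derivative P') (at s)" and X: "(X has_real_derivative X') (at s)"
  shows "((\<lambda>s. w (P s, X s)) has_real_derivative pd_t w (P s, X s) * P' + pd_x w (P s, X s) * X') (at s)"
proof -
  let ?D = "frechet_derivative w (at (P s, X s))"
  note D = smooth_on_has_derivative[OF w]
  have "((\<lambda>s. w (P s, X s)) has_derivative (\<lambda>h. ?D (P' * h, X' * h))) (at s)"
    by (rule has_derivative_compose[OF has_derivative_Pair[OF P[unfolded has_field_derivative_def]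
          X[unfolded has_field_derivative_def]] D])
  moreover have "h * (?D (1, 0) * P' + ?D (0, 1) * X') = ?D (P' * h, X' * h)" for h
  proof -
    have lin: "linear ?D" by (rule has_derivative_linear[OF D])
    have "?D (P' * h, X' * h) = ?D ((P' * h) *\<^sub>R (1, 0) + (X' * h) *\<^sub>R (0, 1))" by simp
    also have "\<dots> = (P' * h) *\<^sub>R ?D (1, 0) + (X' * h) *\<^sub>R ?D (0, 1)"
      by (simp only: linear_add[OF lin] linear_scale[OF lin])
    finally show ?thesis by (simp add: algebra_simps)
  qed
  ultimately show ?thesis
    unfolding smooth_on_pd_eq[OF w] by (rule has_derivative_imp_has_field_derivative)
qed

text \<open>The prefix stands for the total space: these are the plain partial derivatives F_t, F_x,
  F_u. The total derivatives D_t F and D_x F of the jet calculus are the combinations in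
  \<open>pd_graph_chain\<close>.\<close>

definition tot_t :: "(total \<Rightarrow> real) \<Rightarrow> total \<Rightarrow> real" where
  "tot_t F z = frechet_derivative F (at z) ((1, 0), 0)"

definition tot_x :: "(total \<Rightarrow> real) \<Rightarrow> total \<Rightarrow> real" where
  "tot_x F z = frechet_derivative F (at z) ((0, 1), 0)"

definition tot_u :: "(total \<Rightarrow> real) \<Rightarrow> total \<Rightarrow> real" where
  "tot_u F z = frechet_derivative F (at z) ((0, 0), 1)"

lemma smooth_on_tot:
  assumes "smooth_on S F"
  shows "smooth_on S (tot_t F)" "smooth_on S (tot_x F)" "smooth_on S (tot_u F)"
  using smooth_on_direction[OF assms] by (simp_all add: tot_t_def[abs_def] tot_x_def[abs_def] tot_u_def[abs_def])

lemma frechet_derivative_tot: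
  assumes "smooth_on S F" "z \<in> S"
  shows "frechet_derivative F (at z) ((a, b), c) = a * tot_t F z + b * tot_x F z + c * tot_u F z"
proof -
  have lin: "linear (frechet_derivative F (at z))"
    by (rule has_derivative_linear[OF smooth_on_has_derivative[OF assms]])
  have "frechet_derivative F (at z) ((a, b), c) =
      frechet_derivative F (at z) (a *\<^sub>R ((1, 0), 0) + b *\<^sub>R ((0, 1), 0) + c *\<^sub>R ((0, 0), 1))"
    by simp
  also have "\<dots> = a *\<^sub>R tot_t F z + b *\<^sub>R tot_x F z + c *\<^sub>R tot_u F z"
    by (simp only: linear_add[OF lin] linear_scale[OF lin] tot_t_def tot_x_def tot_u_def)
  finally show ?thesis by simp
qed

lemma smooth_on_tot_chain:
  assumes F: "smooth_on S F" "((P s, X s), Y s) \<in> S"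
    and P: "(P has_real_derivative P') (at s)" and X: "(X has_real_derivative X') (at s)"
    and Y: "(Y has_real_derivative Y') (at s)"
  shows "((\<lambda>s. F ((P s, X s), Y s)) has_real_derivative tot_t F ((P s, X s), Y s) * P'
    + tot_x F ((P s, X s), Y s) * X' + tot_u F ((P s, X s), Y s) * Y') (at s)"
proof -
  have "((\<lambda>s. F ((P s, X s), Y s)) has_derivative
      (\<lambda>h. frechet_derivative F (at ((P s, X s), Y s)) ((P' * h, X' * h), Y' * h))) (at s)"
    by (rule has_derivative_compose[OF has_derivative_Pair[OF has_derivative_Pair[OF P[unfolded has_field_derivative_def]
          X[unfolded has_field_derivative_def]] Y[unfolded has_field_derivative_def]] smooth_on_has_derivative[OF F]])
  then show ?thesis
    by (rule has_derivative_imp_has_field_derivative) (simp add: frechet_derivative_tot[OF F] algebra_simps)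
qed

subsection \<open>Functions with transformed graphs\<close>

lemma pd_graph_chain:
  assumes F: "smooth_on S F" "(p, f p) \<in> S" and f: "smooth_on W f" "p \<in> W"
  shows "pd_t (\<lambda>p. F (p, f p)) p = tot_t F (p, f p) + tot_u F (p, f p) * pd_t f p"
    and "pd_x (\<lambda>p. F (p, f p)) p = tot_x F (p, f p) + tot_u F (p, f p) * pd_x f p"
proof -
  obtain t x where p: "p = (t, x)" by (cases p)
  note f' = smooth_on_has_derivative[OF f, unfolded p]
  have "((\<lambda>s. F ((s, x), f (s, x))) has_real_derivative
      tot_t F ((t, x), f (t, x)) * 1 + tot_x F ((t, x), f (t, x)) * 0
      + tot_u F ((t, x), f (t, x)) * frechet_derivative f (at (t, x)) (1, 0)) (at t)"
    by (rule smooth_on_tot_chain[OF F(1) _ DERIV_ident DERIV_const has_derivative_pd(1)[OF f']])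
      (use F(2) p in simp)
  then show "pd_t (\<lambda>p. F (p, f p)) p = tot_t F (p, f p) + tot_u F (p, f p) * pd_t f p"
    unfolding pd_t_def[of "\<lambda>p. F (p, f p)"] smooth_on_pd_eq[OF f] by (auto simp: p dest: DERIV_imp_deriv)
  have "((\<lambda>s. F ((t, s), f (t, s))) has_real_derivative
      tot_t F ((t, x), f (t, x)) * 0 + tot_x F ((t, x), f (t, x)) * 1
      + tot_u F ((t, x), f (t, x)) * frechet_derivative f (at (t, x)) (0, 1)) (at x)"
    by (rule smooth_on_tot_chain[OF F(1) _ DERIV_const DERIV_ident has_derivative_pd(2)[OF f']])
      (use F(2) p in simp)
  then show "pd_x (\<lambda>p. F (p, f p)) p = tot_x F (p, f p) + tot_u F (p, f p) * pd_x f p"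
    unfolding pd_x_def[of "\<lambda>p. F (p, f p)"] smooth_on_pd_eq[OF f] by (auto simp: p dest: DERIV_imp_deriv)
qed

text \<open>The assumption \<open>J\<close> says that D_t T D_x X - D_x T D_t X, the Jacobian of p
  -> (T, X)(p, f p), is nonzero. This map then has a smooth local inverse, so the image of the graph
  is again a graph, with g obtained by carrying U along the inverse.\<close>

lemma prolong2_pair_exists:
  fixes T X U :: "total \<Rightarrow> real" and f :: "base \<Rightarrow> real"
  defines "\<Phi> \<equiv> \<lambda>z. ((T z, X z), U z)"
  assumes Q: "open Q" and smooth: "smooth_on Q T" "smooth_on Q X" "smooth_on Q U"
    and f: "smooth_on UNIV f" and p: "(p, f p) \<in> Q"
    and J: "(tot_t T (p, f p) + tot_u T (p, f p) * pd_t f p) * (tot_x X (p, f p) + tot_u X (p, f p) * pd_x f p)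
      - (tot_x T (p, f p) + tot_u T (p, f p) * pd_x f p) * (tot_t X (p, f p) + tot_u X (p, f p) * pd_t f p) \<noteq> 0"
  obtains W V g where "open W" "p \<in> W" "\<And>p. p \<in> W \<Longrightarrow> (p, f p) \<in> Q" "open V" "smooth_on V g"
    "\<And>p. p \<in> W \<Longrightarrow> (T (p, f p), X (p, f p)) \<in> V"
    "\<And>p. p \<in> W \<Longrightarrow> g (T (p, f p), X (p, f p)) = U (p, f p)"
    "(jet2 f p, jet2 g (T (p, f p), X (p, f p))) \<in> prolong2 Q \<Phi>"
proof -
  define S where "S = (\<lambda>p. (p, f p)) -` Q"
  have cont: "continuous_on UNIV (\<lambda>p. (p, f p))"
    by (intro continuous_intros smooth_on_imp_continuous_on f)
  have S: "open S"
    unfolding S_def by (rule open_vimage[OF Q cont])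
  have fS: "smooth_on S f" using f by (rule smooth_on_subset) simp
  have graph: "smooth_on S (\<lambda>p. (p, f p))"
    by (intro smooth_intros S fS)
  have sub: "(\<lambda>p. (p, f p)) ` S \<subseteq> Q" by (auto simp: S_def)
  define F where "F p = (T (p, f p), X (p, f p))" for p
  have sT: "smooth_on S (\<lambda>p. T (p, f p))" and sX: "smooth_on S (\<lambda>p. X (p, f p))"
    and sU: "smooth_on S (\<lambda>p. U (p, f p))"
    using smooth_on_compose[OF _ S graph sub] smooth by auto
  have sF: "smooth_on S F"
    unfolding F_def by (rule smooth_on_Pair[OF S sT sX])
  have pS: "p \<in> S" using p by (simp add: S_def)
  have F': "frechet_derivative F (at p) = (\<lambda>v. (frechet_derivative (\<lambda>p. T (p, f p)) (at p) v,
      frechet_derivative (\<lambda>p. X (p, f p)) (at p) v))"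
    using frechet_derivative_at[OF has_derivative_Pair[OF smooth_on_has_derivative[OF sT pS]
          smooth_on_has_derivative[OF sX pS]]] by (simp add: F_def[abs_def])
  have "fst (frechet_derivative F (at p) (1, 0)) * snd (frechet_derivative F (at p) (0, 1)) -
      fst (frechet_derivative F (at p) (0, 1)) * snd (frechet_derivative F (at p) (1, 0)) \<noteq> 0"
    using J by (simp add: F' smooth_on_pd_eq[OF sT pS, symmetric] smooth_on_pd_eq[OF sX pS, symmetric]
        pd_graph_chain[OF smooth(1) p f UNIV_I] pd_graph_chain[OF smooth(2) p f UNIV_I])
  then obtain W G where W: "open W" "p \<in> W" "W \<subseteq> S" "open (F ` W)" "smooth_on (F ` W) G"
    "\<And>x. x \<in> W \<Longrightarrow> G (F x) = x"
    by (rule smooth_inverse_plane[OF S sF pS]) blast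
  define g where "g y = U (G y, f (G y))" for y
  have g: "smooth_on (F ` W) g"
    unfolding g_def by (rule smooth_on_compose[OF sU W(4,5)]) (use W(3,6) in auto)
  have gF: "g (F x) = U (x, f x)" if "x \<in> W" for x
    using W(6)[OF that] by (simp add: g_def)
  have "\<Phi> ` graph_on W f = graph_on (F ` W) g"
    unfolding graph_on_def image_image by (auto simp: \<Phi>_def gF F_def[symmetric] intro!: image_cong)
  moreover have "graph_on W f \<subseteq> Q"
    using W(3) by (auto simp: graph_on_def S_def)
  moreover have "F p \<in> F ` W" "\<Phi> (p, f p) = (F p, g (F p))"
    using W(2) gF[OF W(2)] by (auto simp: \<Phi>_def F_def)
  ultimately have "(jet2 f p, jet2 g (F p)) \<in> prolong2 Q \<Phi>"
    unfolding prolong2_def using W(1,2,4) g smooth_on_subset[OF f subset_UNIV] by blast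
  then show ?thesis
    using that[OF W(1,2) _ W(4) g] W(3) gF by (auto simp: F_def S_def)
qed

text \<open>The first-order identity holds on all of N and can therefore be differentiated again at
  0. There g_tt and both mixed derivatives carry a factor \<open>P' 0\<close>, so a curve that is
  stationary in time sees only g_xx.\<close>

lemma plane_curve_chain:
  assumes V: "open V" and g: "smooth_on V g" and N: "open N" "0 \<in> N"
    and in_V: "\<And>s. s \<in> N \<Longrightarrow> (P s, X s) \<in> V" and eq: "\<And>s. s \<in> N \<Longrightarrow> g (P s, X s) = Y s"
    and P: "\<And>s. s \<in> N \<Longrightarrow> (P has_real_derivative P' s) (at s)" "(P' has_real_derivative P'') (at 0)"
    and X: "\<And>s. s \<in> N \<Longrightarrow> (X has_real_derivative X' s) (at s)" "(X' has_real_derivative X'') (at 0)"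
    and Y: "\<And>s. s \<in> N \<Longrightarrow> (Y has_real_derivative Y' s) (at s)" "(Y' has_real_derivative Y'') (at 0)"
  defines "q \<equiv> (P 0, X 0)"
  shows "Y' 0 = pd_t g q * P' 0 + pd_x g q * X' 0"
    and "P' 0 = 0 \<Longrightarrow> Y'' = pd_x (pd_x g) q * (X' 0)\<^sup>2 + pd_t g q * P'' + pd_x g q * X''"
proof -
  have Y': "Y' s = pd_t g (P s, X s) * P' s + pd_x g (P s, X s) * X' s" if s: "s \<in> N" for s
  proof -
    have "((\<lambda>s. g (P s, X s)) has_real_derivative Y' s) (at s)"
      by (rule has_field_derivative_transform_within_open[OF Y(1)[OF s] N(1) s]) (simp add: eq)
    then show ?thesis
      using smooth_on_pd_chain[OF g in_V[OF s] P(1)[OF s] X(1)[OF s]] by (rule DERIV_unique)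
  qed
  then show "Y' 0 = pd_t g q * P' 0 + pd_x g q * X' 0"
    using N(2) by (simp add: q_def)
  assume P0: "P' 0 = 0"
  note sm = smooth_on_pd[OF V g]
  note D = smooth_on_pd_chain[OF _ in_V[OF N(2)] P(1)[OF N(2)] X(1)[OF N(2)]]
  have 1: "((\<lambda>s. pd_t g (P s, X s) * P' s + pd_x g (P s, X s) * X' s) has_real_derivative
      pd_x (pd_x g) q * (X' 0)\<^sup>2 + pd_t g q * P'' + pd_x g q * X'') (at 0)"
    by (rule DERIV_cong[OF DERIV_add[OF DERIV_mult[OF D[OF sm(1)] P(2)] DERIV_mult[OF D[OF sm(2)] X(2)]]])
      (simp add: P0 q_def power2_eq_square)
  have 2: "((\<lambda>s. pd_t g (P s, X s) * P' s + pd_x g (P s, X s) * X' s) has_real_derivative Y'') (at 0)"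
    by (rule has_field_derivative_transform_within_open[OF Y(2) N]) (simp add: Y')
  show "Y'' = pd_x (pd_x g) q * (X' 0)\<^sup>2 + pd_t g q * P'' + pd_x g q * X''"
    by (rule DERIV_unique[OF 2 1])
qed

text \<open>The Hessian form of F on the vector (a, b, c), the second derivative of F along a
  straight line. Mixed derivatives appear in both orders, so no symmetry theorem is invoked.\<close>

definition hess :: "(total \<Rightarrow> real) \<Rightarrow> total \<Rightarrow> real \<Rightarrow> real \<Rightarrow> real \<Rightarrow> real" where
  "hess F z a b c =
     (tot_t (tot_t F) z * a + tot_x (tot_t F) z * b + tot_u (tot_t F) z * c) * a +
     (tot_t (tot_x F) z * a + tot_x (tot_x F) z * b + tot_u (tot_x F) z * c) * b +
     (tot_t (tot_u F) z * a + tot_x (tot_u F) z * b + tot_u (tot_u F) z * c) * c"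

text \<open>The curve is a line of the base lifted to the graph of a quadratic polynomial; k is the
  second derivative of the polynomial along that line and produces the extra term with F_u.\<close>

lemma parabola_derivatives:
  fixes t x u v1 v2 v3 k :: real
  defines "\<gamma> \<equiv> \<lambda>s. ((t + s * v1, x + s * v2), u + s * v3 + k * s\<^sup>2 / 2)"
    and "F1 \<equiv> \<lambda>F s. tot_t F ((t + s * v1, x + s * v2), u + s * v3 + k * s\<^sup>2 / 2) * v1
      + tot_x F ((t + s * v1, x + s * v2), u + s * v3 + k * s\<^sup>2 / 2) * v2
      + tot_u F ((t + s * v1, x + s * v2), u + s * v3 + k * s\<^sup>2 / 2) * (v3 + k * s)"
  assumes F: "smooth_on S F"
  shows "\<gamma> s \<in> S \<Longrightarrow> ((\<lambda>s. F (\<gamma> s)) has_real_derivative F1 F s) (at s)"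
    and "((t, x), u) \<in> S \<Longrightarrow>
      (F1 F has_real_derivative hess F ((t, x), u) v1 v2 v3 + k * tot_u F ((t, x), u)) (at 0)"
proof -
  have d: "((\<lambda>s. t + s * v1) has_real_derivative v1) (at s)"
    "((\<lambda>s. x + s * v2) has_real_derivative v2) (at s)"
    "((\<lambda>s. u + s * v3 + k * s\<^sup>2 / 2) has_real_derivative v3 + k * s) (at s)"
    "((\<lambda>s. v3 + k * s) has_real_derivative k) (at s)" for s
    by (auto intro!: derivative_eq_intros)
  note D = smooth_on_tot_chain[OF _ _ d(1,2,3)]
  show "((\<lambda>s. F (\<gamma> s)) has_real_derivative F1 F s) (at s)" if "\<gamma> s \<in> S"
    unfolding \<gamma>_def F1_def by (rule D[OF F that[unfolded \<gamma>_def]])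
  assume z: "((t, x), u) \<in> S"
  then have z0: "((t + 0 * v1, x + 0 * v2), u + 0 * v3 + k * 0\<^sup>2 / 2) \<in> S" by simp
  note sm = smooth_on_tot[OF F]
  show "(F1 F has_real_derivative hess F ((t, x), u) v1 v2 v3 + k * tot_u F ((t, x), u)) (at 0)"
    unfolding F1_def
    by (rule DERIV_cong[OF DERIV_add[OF DERIV_add[OF DERIV_mult[OF D[OF sm(1) z0] DERIV_const]
          DERIV_mult[OF D[OF sm(2) z0] DERIV_const]] DERIV_mult[OF D[OF sm(3) z0] d(4)]]])
      (simp add: hess_def algebra_simps)
qed

subsection \<open>The determining equations\<close>

text \<open>A Taylor polynomial at (t, x): c and e are the values of f_tt and f_xx, hence the
  halves, and f_tx is 0.\<close>

definition quadratic :: "real \<Rightarrow> real \<Rightarrow> real \<Rightarrow> real \<Rightarrow> real \<Rightarrow> real \<Rightarrow> real \<Rightarrow> base \<Rightarrow> real" where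
  "quadratic t x u a b c e p =
     u + a * (fst p - t) + b * (snd p - x) + c * (fst p - t)\<^sup>2 / 2 + e * (snd p - x)\<^sup>2 / 2"

lemma smooth_on_quadratic: "smooth_on UNIV (quadratic t x u a b c e)"
  unfolding quadratic_def by (intro smooth_intros) auto

lemma jet2_quadratic: "jet2 (quadratic t x u a b c e) (t, x) = ((t, x), u, a, b, c, 0, e)"
proof -
  have "pd_t (quadratic t x u a b c e) = (\<lambda>p. a + c * (fst p - t))"
  proof
    fix p
    have "((\<lambda>s. quadratic t x u a b c e (s, snd p)) has_real_derivative a + c * (fst p - t)) (at (fst p))"
      unfolding quadratic_def by (auto intro!: derivative_eq_intros)
    then show "pd_t (quadratic t x u a b c e) p = a + c * (fst p - t)"
      unfolding pd_t_def by (rule DERIV_imp_deriv)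
  qed
  moreover have "pd_x (quadratic t x u a b c e) = (\<lambda>p. b + e * (snd p - x))"
  proof
    fix p
    have "((\<lambda>y. quadratic t x u a b c e (fst p, y)) has_real_derivative b + e * (snd p - x)) (at (snd p))"
      unfolding quadratic_def by (auto intro!: derivative_eq_intros)
    then show "pd_x (quadratic t x u a b c e) p = b + e * (snd p - x)"
      unfolding pd_x_def by (rule DERIV_imp_deriv)
  qed
  moreover have "pd_t (\<lambda>p. a + c * (fst p - t)) (t, x) = c"
    unfolding pd_t_def by (rule DERIV_imp_deriv) (auto intro!: derivative_eq_intros)
  moreover have "pd_t (\<lambda>p. b + e * (snd p - x)) (t, x) = 0"
    by (simp add: pd_t_def)
  moreover have "pd_x (\<lambda>p. b + e * (snd p - x)) (t, x) = e"
    unfolding pd_x_def by (rule DERIV_imp_deriv) (auto intro!: derivative_eq_intros)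
  ultimately show ?thesis
    by (simp add: jet2_def quadratic_def)
qed

text \<open>\<open>nondegenerate\<close> is linear independence of the rows of the Jacobian matrix
  of \<Phi>, put so that a contradiction arises from a single annihilating covector (l, m, n).
  \<open>maps\<close> is the passage from source jets to target jets, on which necessity
  rests.\<close>

locale kolmogorov_map =
  fixes \<epsilon> :: real and Q :: "total set" and T X U :: "total \<Rightarrow> real" and B B' :: "base \<Rightarrow> real"
  assumes eps: "\<epsilon> \<noteq> 0" and Q: "open Q"
    and smooth: "smooth_on Q T" "smooth_on Q X" "smooth_on Q U"
    and nondegenerate: "\<And>z l m n. z \<in> Q \<Longrightarrow> l * tot_t T z + m * tot_t X z + n * tot_t U z = 0 \<Longrightarrow>
      l * tot_x T z + m * tot_x X z + n * tot_x U z = 0 \<Longrightarrow>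
      l * tot_u T z + m * tot_u X z + n * tot_u U z = 0 \<Longrightarrow> l = 0 \<and> m = 0 \<and> n = 0"
    and maps: "\<And>j j'. (j, j') \<in> prolong2 Q (\<lambda>z. ((T z, X z), U z)) \<Longrightarrow>
      j \<in> kolmogorov \<epsilon> B \<Longrightarrow> j' \<in> kolmogorov \<epsilon> B'"
begin

text \<open>\<open>H\<close> and \<open>G\<close> are g_t and g_x at the image point,
  \<open>D1\<close> and \<open>D2\<close> the total derivatives, \<open>L F\<close> the second
  derivative of F along the lifted line with direction (- D_x T, D_t T). On it the T-velocity is 0
  and the X-velocity is J, so g_xx J^2 = L U - g_t L T - g_x L X. Multiplying the target equation by
  J^2 eliminates g_xx. The value of \<open>a\<close> is dictated by the source equation.\<close>

lemma determining_equation: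
  fixes t x u b c e
  defines "z \<equiv> ((t, x), u)" and "a \<equiv> \<epsilon> * e + B (t, x) * b"
  defines "D1 \<equiv> \<lambda>F. tot_t F z + a * tot_u F z" and "D2 \<equiv> \<lambda>F. tot_x F z + b * tot_u F z"
  defines "J \<equiv> D1 T * D2 X - D2 T * D1 X"
  defines "L \<equiv> \<lambda>F. hess F z (- D2 T) (D1 T) (b * D1 T - a * D2 T)
    + (c * (D2 T)\<^sup>2 + e * (D1 T)\<^sup>2) * tot_u F z"
  assumes z: "z \<in> Q" and J: "J \<noteq> 0"
  obtains H G where "D1 U = H * D1 T + G * D1 X" "D2 U = H * D2 T + G * D2 X"
    "H * J\<^sup>2 = \<epsilon> * (L U - H * L T - G * L X) + B' (T z, X z) * G * J\<^sup>2"
proof -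
  define f where "f = quadratic t x u a b c e"
  have jf: "jet2 f (t, x) = ((t, x), u, a, b, c, 0, e)"
    unfolding f_def by (rule jet2_quadratic)
  then have f0: "f (t, x) = u" "pd_t f (t, x) = a" "pd_x f (t, x) = b"
    by (auto simp: jet2_def)
  note smf = smooth_on_quadratic[of t x u a b c e, folded f_def]
  have zf: "((t, x), f (t, x)) \<in> Q" using z by (simp add: f0 z_def)
  have J': "(tot_t T ((t, x), f (t, x)) + tot_u T ((t, x), f (t, x)) * pd_t f (t, x))
      * (tot_x X ((t, x), f (t, x)) + tot_u X ((t, x), f (t, x)) * pd_x f (t, x))
      - (tot_x T ((t, x), f (t, x)) + tot_u T ((t, x), f (t, x)) * pd_x f (t, x))
      * (tot_t X ((t, x), f (t, x)) + tot_u X ((t, x), f (t, x)) * pd_t f (t, x)) \<noteq> 0"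
    using J by (simp add: f0 J_def D1_def D2_def z_def mult.commute)
  obtain W V g where W: "open W" "(t, x) \<in> W" "\<And>p. p \<in> W \<Longrightarrow> (p, f p) \<in> Q" "open V" "smooth_on V g"
    "\<And>p. p \<in> W \<Longrightarrow> (T (p, f p), X (p, f p)) \<in> V"
    "\<And>p. p \<in> W \<Longrightarrow> g (T (p, f p), X (p, f p)) = U (p, f p)"
    and pair: "(jet2 f (t, x), jet2 g (T ((t, x), f (t, x)), X ((t, x), f (t, x))))
      \<in> prolong2 Q (\<lambda>z. ((T z, X z), U z))"
    by (rule prolong2_pair_exists[OF Q smooth smf zf J']) blast
  define q where "q = (T z, X z)"
  have "jet2 g q \<in> kolmogorov \<epsilon> B'"
    using maps[OF pair] by (simp add: jf f0 q_def z_def kolmogorov_def a_def)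
  then have eq: "pd_t g q = \<epsilon> * pd_x (pd_x g) q + B' q * pd_x g q"
    by (simp add: jet2_def kolmogorov_def)
  \<comment> \<open>Kept for an arbitrary direction (v1, v2): the coordinate directions give the two
    linear equations for g_t and g_x, the direction (- D2 T, D1 T) the second-order one.\<close>
  have curve: "v1 * D1 U + v2 * D2 U = pd_t g q * (v1 * D1 T + v2 * D2 T) + pd_x g q * (v1 * D1 X + v2 * D2 X)"
    and curve2: "v1 * D1 T + v2 * D2 T = 0 \<Longrightarrow> M U = pd_x (pd_x g) q * (v1 * D1 X + v2 * D2 X)\<^sup>2
      + pd_t g q * M T + pd_x g q * M X"
    if M: "M = (\<lambda>F. hess F z v1 v2 (a * v1 + b * v2) + (c * v1\<^sup>2 + e * v2\<^sup>2) * tot_u F z)" for v1 v2 M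
  proof -
    define N where "N = (\<lambda>s. (t + s * v1, x + s * v2)) -` W"
    have N: "open N" "0 \<in> N"
      unfolding N_def using W(2) by (auto intro!: open_vimage W(1) continuous_intros)
    define v3 k where "v3 = a * v1 + b * v2" and "k = c * v1\<^sup>2 + e * v2\<^sup>2"
    have fc: "f (t + s * v1, x + s * v2) = u + s * v3 + k * s\<^sup>2 / 2" for s
      by (simp add: f_def quadratic_def v3_def k_def power2_eq_square field_simps)
    have inW: "(t + s * v1, x + s * v2) \<in> W" if "s \<in> N" for s
      using that by (simp add: N_def)
    have inQ: "((t + s * v1, x + s * v2), u + s * v3 + k * s\<^sup>2 / 2) \<in> Q" if "s \<in> N" for s
      using W(3)[OF inW[OF that]] by (simp add: fc)
    note d = parabola_derivatives(1)[OF _ inQ] and d2 = parabola_derivatives(2)[OF _ z[unfolded z_def]]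
    note chain = plane_curve_chain[OF W(4,5) N W(6)[OF inW, unfolded fc] W(7)[OF inW, unfolded fc]
        d[OF smooth(1)] d2[OF smooth(1)] d[OF smooth(2)] d2[OF smooth(2)] d[OF smooth(3)] d2[OF smooth(3)]]
    show "v1 * D1 U + v2 * D2 U = pd_t g q * (v1 * D1 T + v2 * D2 T) + pd_x g q * (v1 * D1 X + v2 * D2 X)"
      using chain(1) by (simp add: q_def z_def D1_def D2_def v3_def algebra_simps)
    assume "v1 * D1 T + v2 * D2 T = 0"
    then have 0: "tot_t T z * v1 + tot_x T z * v2 + tot_u T z * v3 = 0"
      by (simp add: D1_def D2_def v3_def algebra_simps)
    have X': "v1 * D1 X + v2 * D2 X = tot_t X z * v1 + tot_x X z * v2 + tot_u X z * v3"
      by (simp add: D1_def D2_def v3_def algebra_simps)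
    show "M U = pd_x (pd_x g) q * (v1 * D1 X + v2 * D2 X)\<^sup>2 + pd_t g q * M T + pd_x g q * M X"
      unfolding X' M using chain(2) 0 by (simp add: q_def z_def v3_def[symmetric] k_def[symmetric])
  qed
  show ?thesis
  proof (rule that)
    show "D1 U = pd_t g q * D1 T + pd_x g q * D1 X" using curve[OF refl, of 1 0] by simp
    show "D2 U = pd_t g q * D2 T + pd_x g q * D2 X" using curve[OF refl, of 0 1] by simp
    have "L U = pd_x (pd_x g) q * J\<^sup>2 + pd_t g q * L T + pd_x g q * L X"
      using curve2[OF refl, of "- D2 T" "D1 T"] by (simp add: L_def J_def algebra_simps)
    then have "pd_x (pd_x g) q * J\<^sup>2 = L U - pd_t g q * L T - pd_x g q * L X" by simp
    moreover have "pd_t g q * J\<^sup>2 = \<epsilon> * (pd_x (pd_x g) q * J\<^sup>2) + B' q * pd_x g q * J\<^sup>2"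
      unfolding eq by (simp add: algebra_simps)
    ultimately show "pd_t g q * J\<^sup>2 = \<epsilon> * (L U - pd_t g q * L T - pd_x g q * L X)
        + B' (T z, X z) * pd_x g q * J\<^sup>2"
      by (simp add: q_def)
  qed
qed

end

text \<open>Where the Jacobian is nonzero, the 1-jet of f determines g_t and g_x; test functions
  that differ only in f_tt then share \<open>H\<close> and \<open>G\<close>.\<close>

lemma cramer_unique:
  fixes h g :: real
  assumes "h * p + g * r = 0" "h * q + g * s = 0" "p * s - q * r \<noteq> 0"
  shows "h = 0" "g = 0"
proof -
  have "h * (p * s - q * r) = 0" "g * (p * s - q * r) = 0"
    using assms(1,2) by algebra+
  then show "h = 0" "g = 0"
    using assms(3) by simp_all
qed

context kolmogorov_map
begin

text \<open>This is the factor U_u - g_t T_u - g_x X_u at the second derivatives of f. If it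
  vanishes, the a- and b-terms of the two assumptions cancel, and (h, g, -1) annihilates all columns
  of the Jacobian matrix.\<close>

lemma characteristic_nonzero:
  assumes z: "z \<in> Q"
    and "tot_t U z + a * tot_u U z = h * (tot_t T z + a * tot_u T z) + g * (tot_t X z + a * tot_u X z)"
    and "tot_x U z + b * tot_u U z = h * (tot_x T z + b * tot_u T z) + g * (tot_x X z + b * tot_u X z)"
  shows "tot_u U z - h * tot_u T z - g * tot_u X z \<noteq> 0"
proof
  assume 0: "tot_u U z - h * tot_u T z - g * tot_u X z = 0"
  have "h * tot_t T z + g * tot_t X z + (- 1) * tot_t U z = 0"
    "h * tot_x T z + g * tot_x X z + (- 1) * tot_x U z = 0"
    "h * tot_u T z + g * tot_u X z + (- 1) * tot_u U z = 0"
    using assms(2,3) 0 by algebra+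
  then show False
    using nondegenerate[OF z, of h g "- 1"] by simp
qed

text \<open>Raising f_tt from 0 to 1 keeps the 1-jet of f, hence \<open>H\<close> and
  \<open>G\<close>, and changes the determining equation by \<epsilon> (D_x T)^2 times the nonzero
  factor of \<open>characteristic_nonzero\<close>. So T_x + b T_u = 0 for each admissible slope b,
  and two different slopes separate T_u from T_x.\<close>

lemma time_fibre_preserving:
  assumes z: "z \<in> Q"
  shows "tot_x T z = 0" "tot_u T z = 0"
proof -
  obtain t x u where zt: "z = ((t, x), u)" by (metis surj_pair)
  define J where "J a b = (tot_t T z + a * tot_u T z) * (tot_x X z + b * tot_u X z)
      - (tot_x T z + b * tot_u T z) * (tot_t X z + a * tot_u X z)" for a b
  have key: "tot_x T z + b * tot_u T z = 0" if J: "J a b \<noteq> 0" for a b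
  proof -
    \<comment> \<open>The source equation can be solved for f_xx, so f_t and f_x may be prescribed
      independently.\<close>
    define e where "e = (a - B (t, x) * b) / \<epsilon>"
    have a: "\<epsilon> * e + B (t, x) * b = a" using eps by (simp add: e_def)
    note eqn = determining_equation[of t x u e b, unfolded a, folded zt, OF z J[unfolded J_def], folded J_def]
    define D where "D = tot_x T z + b * tot_u T z"
    define M where "M c F = hess F z (- (tot_x T z + b * tot_u T z)) (tot_t T z + a * tot_u T z)
      (b * (tot_t T z + a * tot_u T z) - a * (tot_x T z + b * tot_u T z))
      + (c * (tot_x T z + b * tot_u T z)\<^sup>2 + e * (tot_t T z + a * tot_u T z)\<^sup>2) * tot_u F z" for c F
    have M: "M 1 F = M 0 F + D\<^sup>2 * tot_u F z" for F
      by (simp add: M_def D_def algebra_simps)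
    obtain H G where 0: "tot_t U z + a * tot_u U z = H * (tot_t T z + a * tot_u T z) + G * (tot_t X z + a * tot_u X z)"
      "tot_x U z + b * tot_u U z = H * (tot_x T z + b * tot_u T z) + G * (tot_x X z + b * tot_u X z)"
      "H * (J a b)\<^sup>2 = \<epsilon> * (M 0 U - H * M 0 T - G * M 0 X) + B' (T z, X z) * G * (J a b)\<^sup>2"
      unfolding M_def by (rule eqn[of 0]) blast
    obtain H' G' where 1: "tot_t U z + a * tot_u U z = H' * (tot_t T z + a * tot_u T z) + G' * (tot_t X z + a * tot_u X z)"
      "tot_x U z + b * tot_u U z = H' * (tot_x T z + b * tot_u T z) + G' * (tot_x X z + b * tot_u X z)"
      "H' * (J a b)\<^sup>2 = \<epsilon> * (M 1 U - H' * M 1 T - G' * M 1 X) + B' (T z, X z) * G' * (J a b)\<^sup>2"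
      unfolding M_def by (rule eqn[of 1]) blast
    have "(H' - H) * (tot_t T z + a * tot_u T z) + (G' - G) * (tot_t X z + a * tot_u X z) = 0"
      "(H' - H) * (tot_x T z + b * tot_u T z) + (G' - G) * (tot_x X z + b * tot_u X z) = 0"
      using 0(1,2) 1(1,2) by algebra+
    from cramer_unique[OF this J[unfolded J_def]] have "H' = H" "G' = G" by simp_all
    with 0(3) 1(3) have "\<epsilon> * D\<^sup>2 * (tot_u U z - H * tot_u T z - G * tot_u X z) = 0"
      by (simp add: M algebra_simps)
    then have "D = 0"
      using eps characteristic_nonzero[OF z 0(1,2)] by simp
    then show ?thesis by (simp add: D_def)
  qed
  \<comment> \<open>The minors of the T- and X-rows. The products of a and b cancel in J, which is
    therefore affine in (a, b); if all minors vanished, the two rows would be linearly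
    dependent.\<close>
  define j0 ja jb where "j0 = tot_t T z * tot_x X z - tot_x T z * tot_t X z"
    and "ja = tot_u T z * tot_x X z - tot_x T z * tot_u X z"
    and "jb = tot_t T z * tot_u X z - tot_u T z * tot_t X z"
  have J: "J a b = j0 + ja * a + jb * b" for a b
    by (simp add: J_def j0_def ja_def jb_def algebra_simps)
  have "\<not> (j0 = 0 \<and> ja = 0 \<and> jb = 0)"
  proof
    assume 0: "j0 = 0 \<and> ja = 0 \<and> jb = 0"
    have "tot_x X z = 0" "tot_x T z = 0"
      using nondegenerate[OF z, of "tot_x X z" "- tot_x T z" 0] 0
      by (auto simp: j0_def ja_def jb_def algebra_simps)
    moreover have "tot_t X z = 0" "tot_t T z = 0"
      using nondegenerate[OF z, of "tot_t X z" "- tot_t T z" 0] 0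
      by (auto simp: j0_def ja_def jb_def algebra_simps)
    moreover have "tot_u X z = 0" "tot_u T z = 0"
      using nondegenerate[OF z, of "tot_u X z" "- tot_u T z" 0] 0
      by (auto simp: j0_def ja_def jb_def algebra_simps)
    ultimately show False
      using nondegenerate[OF z, of 1 0 0] by simp
  qed
  \<comment> \<open>The witnesses solve J = 1 or J = 2 for a variable with nonzero coefficient; if J
    is constant, the slopes 0 and 1 serve.\<close>
  then obtain a b a' b' where ab: "J a b \<noteq> 0" "J a' b' \<noteq> 0" "b \<noteq> b'"
  proof (cases "ja = 0")
    case False
    then have "J ((1 - j0) / ja) 0 \<noteq> 0" "J ((1 - j0 - jb) / ja) 1 \<noteq> 0"
      by (simp_all add: J)
    then show ?thesis by (rule that) simp
  next
    case ja: True
    show ?thesis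
    proof (cases "jb = 0")
      case False
      then have "J 0 ((1 - j0) / jb) \<noteq> 0" "J 0 ((2 - j0) / jb) \<noteq> 0" "(1 - j0) / jb \<noteq> (2 - j0) / jb"
        by (simp_all add: J)
      then show ?thesis by (rule that)
    next
      case True
      then have "J 0 0 \<noteq> 0" "J 0 1 \<noteq> 0"
        using ja \<open>\<not> (j0 = 0 \<and> ja = 0 \<and> jb = 0)\<close> by (simp_all add: J)
      then show ?thesis by (rule that) simp
    qed
  qed
  have "(b - b') * tot_u T z = 0"
    using key[OF ab(1)] key[OF ab(2)] by algebra
  then show "tot_u T z = 0" using ab(3) by simp
  then show "tot_x T z = 0" using key[OF ab(1)] by simp
qed

lemma time_derivative_nonzero: "z \<in> Q \<Longrightarrow> tot_t T z \<noteq> 0"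
  using nondegenerate[of z 1 0 0] time_fibre_preserving[of z] by auto

lemma frechet_derivative_zero_on:
  "(\<And>z. z \<in> Q \<Longrightarrow> F z = 0) \<Longrightarrow> z \<in> Q \<Longrightarrow> frechet_derivative F (at z) = (\<lambda>v. 0)"
  using has_derivative_transform_within_open[OF has_derivative_const[of 0] Q, of z F]
    frechet_derivative_at by metis

lemma hess_time: "z \<in> Q \<Longrightarrow> hess T z 0 b c = 0"
  using frechet_derivative_zero_on[OF time_fibre_preserving(1)]
    frechet_derivative_zero_on[OF time_fibre_preserving(2)]
  by (simp add: hess_def tot_t_def[of "tot_x T"] tot_x_def[of "tot_x T"] tot_u_def[of "tot_x T"]
      tot_t_def[of "tot_u T"] tot_x_def[of "tot_u T"] tot_u_def[of "tot_u T"])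

text \<open>As \<open>T_x = T_u = 0\<close>, the line is horizontal and its lift to the graph has velocity
  \<open>T_t (0, 1, b)\<close>, so \<open>e\<close> enters only through the linear terms.\<close>

lemma reduced_equation:
  fixes t x u b e
  defines "z \<equiv> ((t, x), u)" and "a \<equiv> \<epsilon> * e + B (t, x) * b"
  defines "D \<equiv> tot_x X z + b * tot_u X z"
  defines "L \<equiv> \<lambda>F. hess F z 0 (tot_t T z) (b * tot_t T z) + e * (tot_t T z)\<^sup>2 * tot_u F z"
  assumes z: "z \<in> Q" and D: "D \<noteq> 0"
  obtains H G where "tot_t U z + a * tot_u U z = H * tot_t T z + G * (tot_t X z + a * tot_u X z)"
    "tot_x U z + b * tot_u U z = G * D"
    "H * (tot_t T z * D)\<^sup>2 = \<epsilon> * (L U - G * L X) + B' (T z, X z) * G * (tot_t T z * D)\<^sup>2"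
proof -
  note T0 = time_fibre_preserving[OF z] hess_time[OF z]
  have "(tot_t T z + a * tot_u T z) * (tot_x X z + b * tot_u X z)
      - (tot_x T z + b * tot_u T z) * (tot_t X z + a * tot_u X z) \<noteq> 0"
    using D time_derivative_nonzero[OF z] by (simp add: T0 D_def)
  note eqn = determining_equation[of t x u e b 0, folded z_def a_def, OF z this]
  show ?thesis
    by (rule eqn, rule that) (simp_all add: T0 D_def L_def)
qed

text \<open>Put D = X_x + b X_u and raise f_xx from 0 to 1 at fixed b, so that f_t grows by
  \<epsilon>. Then g_x stays, since b alone determines it, while g_t grows by \<epsilon> \<Lambda> /
  T_t according to the first-order relation and by \<epsilon> \<Lambda> / D^2 according to the
  target equation. Hence D^2 = T_t whenever D is nonzero, which rules out dependence of D on
  b.\<close>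

lemma space_fibre_preserving:
  assumes z: "z \<in> Q"
  shows "tot_u X z = 0" "(tot_x X z)\<^sup>2 = tot_t T z"
proof -
  obtain t x u where zt: "z = ((t, x), u)" by (metis surj_pair)
  have key: "(tot_x X z + b * tot_u X z)\<^sup>2 = tot_t T z" if D: "tot_x X z + b * tot_u X z \<noteq> 0" for b
  proof -
    define D where "D = tot_x X z + b * tot_u X z"
    define a where "a = B (t, x) * b"
    define M where "M e F = hess F z 0 (tot_t T z) (b * tot_t T z) + e * (tot_t T z)\<^sup>2 * tot_u F z" for e F
    have M: "M 1 F = M 0 F + (tot_t T z)\<^sup>2 * tot_u F z" for F
      by (simp add: M_def)
    note eqn = reduced_equation[of t x u b, folded zt, OF z that, folded D_def a_def]
    obtain H G where 0: "tot_t U z + (\<epsilon> * 0 + a) * tot_u U z = H * tot_t T z + G * (tot_t X z + (\<epsilon> * 0 + a) * tot_u X z)"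
      "tot_x U z + b * tot_u U z = G * D"
      "H * (tot_t T z * D)\<^sup>2 = \<epsilon> * (M 0 U - G * M 0 X) + B' (T z, X z) * G * (tot_t T z * D)\<^sup>2"
      unfolding M_def by (rule eqn[of 0]) blast
    obtain H' G' where 1: "tot_t U z + (\<epsilon> * 1 + a) * tot_u U z = H' * tot_t T z + G' * (tot_t X z + (\<epsilon> * 1 + a) * tot_u X z)"
      "tot_x U z + b * tot_u U z = G' * D"
      "H' * (tot_t T z * D)\<^sup>2 = \<epsilon> * (M 1 U - G' * M 1 X) + B' (T z, X z) * G' * (tot_t T z * D)\<^sup>2"
      unfolding M_def by (rule eqn[of 1]) blast
    have D0: "D \<noteq> 0" using D by (simp add: D_def)
    have G: "G' = G" using 0(2) 1(2) D0 by simp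
    define \<Lambda> where "\<Lambda> = tot_u U z - G * tot_u X z"
    have "\<Lambda> \<noteq> 0"
      using characteristic_nonzero[OF z, of a H G b] 0(1,2)
      by (simp add: \<Lambda>_def D_def time_fibre_preserving[OF z])
    have "(H' - H) * tot_t T z = \<epsilon> * \<Lambda>"
      using 0(1) 1(1) unfolding G \<Lambda>_def by algebra
    moreover have "(H' - H) * (tot_t T z * D)\<^sup>2 = \<epsilon> * (tot_t T z)\<^sup>2 * \<Lambda>"
      using 0(3) 1(3) by (simp add: G \<Lambda>_def M algebra_simps)
    ultimately have "\<epsilon> * \<Lambda> * tot_t T z * (D\<^sup>2 - tot_t T z) = 0"
      by algebra
    then show ?thesis
      using eps \<open>\<Lambda> \<noteq> 0\<close> time_derivative_nonzero[OF z] by (simp add: D_def)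
  qed
  show Xu: "tot_u X z = 0"
  proof (rule ccontr)
    assume n: "tot_u X z \<noteq> 0"
    \<comment> \<open>Slopes at which D equals 1 and 2; they would force T_t to be both 1 and
      4.\<close>
    then have "tot_x X z + (1 - tot_x X z) / tot_u X z * tot_u X z = 1"
      "tot_x X z + (2 - tot_x X z) / tot_u X z * tot_u X z = 2"
      by simp_all
    then show False
      using key[of "(1 - tot_x X z) / tot_u X z"] key[of "(2 - tot_x X z) / tot_u X z"] by simp
  qed
  have "tot_x X z \<noteq> 0"
  proof
    assume "tot_x X z = 0"
    then show False
      using nondegenerate[OF z, of "- tot_t X z" "tot_t T z" 0] Xu time_derivative_nonzero[OF z]
      by (simp add: time_fibre_preserving[OF z])
  qed
  then show "(tot_x X z)\<^sup>2 = tot_t T z"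
    using key[of 0] by simp
qed

lemma space_derivative_nonzero: "z \<in> Q \<Longrightarrow> tot_x X z \<noteq> 0"
  using space_fibre_preserving(2)[of z] time_derivative_nonzero[of z] by auto

end

subsection \<open>Functions constant along fibres\<close>

text \<open>By convexity the fibre of Q over a point is an interval, where a vanishing derivative
  means constancy. Near p one height u stays inside the open set Q, so h is locally the restriction
  of F to a horizontal slice and hence smooth. The base type is general because u is removed over
  the plane and x over the line.\<close>

lemma smooth_on_descend:
  fixes F :: "'a::euclidean_space \<times> real \<Rightarrow> real"
  assumes Q: "open Q" "convex Q" and F: "smooth_on Q F"
    and zero: "\<And>z. z \<in> Q \<Longrightarrow> frechet_derivative F (at z) (0, 1) = 0"
  obtains h where "smooth_on (fst ` Q) h" "\<And>z. z \<in> Q \<Longrightarrow> F z = h (fst z)"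
proof -
  have const: "F (p, u) = F (p, v)" if u: "(p, u) \<in> Q" and v: "(p, v) \<in> Q" for p u v
  proof -
    define I where "I = {s. (p, s) \<in> Q}"
    have "convex I"
    proof (rule convexI)
      fix x y a b :: real
      assume "x \<in> I" "y \<in> I" "0 \<le> a" "0 \<le> b" and ab: "a + b = 1"
      then have "a *\<^sub>R (p, x) + b *\<^sub>R (p, y) \<in> Q"
        by (intro convexD[OF Q(2)]) (auto simp: I_def)
      moreover have "a *\<^sub>R p + b *\<^sub>R p = p"
        using ab by (simp flip: scaleR_left.add)
      ultimately show "a *\<^sub>R x + b *\<^sub>R y \<in> I"
        by (simp add: I_def)
    qed
    moreover have "((\<lambda>s. F (p, s)) has_field_derivative 0) (at s within I)" if "s \<in> I" for s
    proof -
      have z: "(p, s) \<in> Q" using that by (simp add: I_def)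
      have d: "((\<lambda>s. F (p, s)) has_derivative (\<lambda>h. frechet_derivative F (at (p, s)) (0, h))) (at s)"
        by (rule has_derivative_compose[OF has_derivative_Pair[OF has_derivative_const has_derivative_ident]
              smooth_on_has_derivative[OF F z]])
      have "h * 0 = frechet_derivative F (at (p, s)) (0, h)" for h
        using linear_scale[OF has_derivative_linear[OF smooth_on_has_derivative[OF F z]], of h "(0, 1)"]
          zero[OF z] by simp
      then have "((\<lambda>s. F (p, s)) has_field_derivative 0) (at s)"
        by (rule has_derivative_imp_has_field_derivative[OF d])
      then show ?thesis by (rule has_field_derivative_at_within)
    qed
    ultimately have "\<exists>c. \<forall>s\<in>I. F (p, s) = c"
      by (rule has_field_derivative_zero_constant)
    then show ?thesis using u v by (auto simp: I_def)
  qed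
  define h where "h p = F (p, SOME u. (p, u) \<in> Q)" for p
  have h: "h p = F (p, u)" if "(p, u) \<in> Q" for p u
    unfolding h_def by (rule const[OF _ that]) (rule someI[of "\<lambda>u. (p, u) \<in> Q", OF that])
  have "smooth_on (fst ` Q) h"
  proof (rule smooth_on_local)
    fix p assume "p \<in> fst ` Q"
    then obtain u where u: "(p, u) \<in> Q" by auto
    define N where "N = (\<lambda>p. (p, u)) -` Q"
    have N: "open N"
    proof -
      have "continuous_on UNIV (\<lambda>p. (p, u))"
        by (intro continuous_on_Pair continuous_on_id continuous_on_const)
      then show ?thesis unfolding N_def by (rule open_vimage[OF Q(1)])
    qed
    have "smooth_on N (\<lambda>p. F (p, u))"
      by (rule smooth_on_compose[OF F N smooth_on_Pair[OF N smooth_on_ident smooth_on_const]])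
        (auto simp: N_def)
    moreover have "h p = F (p, u)" if "p \<in> N" for p
      using that by (intro h) (simp add: N_def)
    ultimately have "smooth_on N h"
      using smooth_on_cong[OF N, of h "\<lambda>p. F (p, u)"] by blast
    then show "\<exists>N. open N \<and> p \<in> N \<and> smooth_on N h"
      using N u by (auto simp: N_def)
  qed
  then show ?thesis
    by (rule that) (use h in auto)
qed

lemma tot_of_base:
  assumes Q: "open Q" "z \<in> Q" and h: "smooth_on (fst ` Q) h" and F: "\<And>z. z \<in> Q \<Longrightarrow> F z = h (fst z)"
  shows "tot_t F z = pd_t h (fst z)" "tot_x F z = pd_x h (fst z)" "tot_u F z = 0"
proof -
  have p: "fst z \<in> fst ` Q" using Q(2) by blast
  let ?D = "frechet_derivative h (at (fst z))"
  have "((\<lambda>z. h (fst z)) has_derivative (\<lambda>v. ?D (fst v))) (at z)"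
    by (rule has_derivative_compose[OF has_derivative_fst[OF has_derivative_ident] smooth_on_has_derivative[OF h p]])
  then have "(F has_derivative (\<lambda>v. ?D (fst v))) (at z)"
    using has_derivative_transform_within_open[OF _ Q] F by (metis (no_types, lifting))
  then have D: "frechet_derivative F (at z) = (\<lambda>v. ?D (fst v))"
    using frechet_derivative_at by metis
  have "linear ?D"
    by (rule has_derivative_linear[OF smooth_on_has_derivative[OF h p]])
  then show "tot_t F z = pd_t h (fst z)" "tot_x F z = pd_x h (fst z)" "tot_u F z = 0"
    using linear_0[of ?D]
    by (simp_all add: tot_t_def tot_x_def tot_u_def D smooth_on_pd_eq[OF h p] zero_prod_def)
qed

lemma pd_cong:
  assumes S: "open S" "p \<in> S" and eq: "\<And>p. p \<in> S \<Longrightarrow> f p = g p"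
  shows "pd_t f p = pd_t g p" "pd_x f p = pd_x g p"
proof -
  obtain A C where AC: "open A" "open C" "p \<in> A \<times> C" "A \<times> C \<subseteq> S"
    using S by (rule open_prod_elim)
  have "eventually (\<lambda>s. f (s, snd p) = g (s, snd p)) (nhds (fst p))"
    by (rule eventually_nhds_in_open[OF AC(1), THEN eventually_mono]) (use AC eq in auto)
  then show "pd_t f p = pd_t g p"
    unfolding pd_t_def by (rule deriv_cong_ev) simp
  have "eventually (\<lambda>y. f (fst p, y) = g (fst p, y)) (nhds (snd p))"
    by (rule eventually_nhds_in_open[OF AC(2), THEN eventually_mono]) (use AC eq in auto)
  then show "pd_x f p = pd_x g p"
    unfolding pd_x_def by (rule deriv_cong_ev) simp
qed

lemma pd_of_time:
  assumes S: "open S" "p \<in> S" and h: "\<And>p. p \<in> S \<Longrightarrow> h p = k (fst p)"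
  shows "pd_t h p = deriv k (fst p)" "pd_x h p = 0"
  using pd_cong[OF S, of h "\<lambda>p. k (fst p)"] h by (simp_all add: pd_t_def pd_x_def)

lemma convex_fst_image:
  fixes Q :: "('a::real_normed_vector \<times> 'b::real_normed_vector) set"
  shows "convex Q \<Longrightarrow> convex (fst ` Q)"
  by (rule convex_linear_image[OF bounded_linear.linear[OF bounded_linear_fst]])

lemma pd_x_has_real_derivative:
  "smooth_on S w \<Longrightarrow> (t, x) \<in> S \<Longrightarrow> ((\<lambda>y. w (t, y)) has_real_derivative pd_x w (t, x)) (at x)"
  using has_derivative_pd(2)[OF smooth_on_has_derivative[of S w "(t, x)"]]
  by (simp add: smooth_on_pd_eq)

lemma pd_t_has_real_derivative:
  "smooth_on S w \<Longrightarrow> (t, x) \<in> S \<Longrightarrow> ((\<lambda>s. w (s, x)) has_real_derivative pd_t w (t, x)) (at t)"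
  using has_derivative_pd(1)[OF smooth_on_has_derivative[of S w "(t, x)"]]
  by (simp add: smooth_on_pd_eq)

lemma tot_u_has_real_derivative:
  "smooth_on S w \<Longrightarrow> (p, u) \<in> S \<Longrightarrow> ((\<lambda>v. w (p, v)) has_real_derivative tot_u w (p, u)) (at u)"
  using smooth_on_tot_chain[of S w "\<lambda>_. fst p" u "\<lambda>_. snd p" "\<lambda>v. v" 0 0 1] by simp

context kolmogorov_map
begin

text \<open>T loses u and then x by two descents. For X, differentiating X_x^2 = T_t(t) in x gives 2
  X_x X_xx = 0, so X_x depends on t alone, without a square root or a choice of sign. The last
  conclusion removes X from the second-order part of \<open>reduced_equation\<close>.\<close>

lemma space_affine:
  assumes conv: "convex Q"
  obtains \<tau> X0 X1 where "smooth_on (fst ` fst ` Q) \<tau>" "smooth_on (fst ` fst ` Q) X0" "smooth_on (fst ` fst ` Q) X1"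
    "\<And>t x u. ((t, x), u) \<in> Q \<Longrightarrow> T ((t, x), u) = \<tau> t \<and> X ((t, x), u) = X1 t * x + X0 t \<and>
      X1 t \<noteq> 0 \<and> deriv \<tau> t = (X1 t)\<^sup>2"
    "\<And>z b c. z \<in> Q \<Longrightarrow> hess X z 0 b c = 0"
proof -
  have S: "open (fst ` Q)" "convex (fst ` Q)"
    using Q conv by (auto intro: open_image_fst convex_fst_image)
  have I: "open (fst ` fst ` Q)" "convex (fst ` fst ` Q)"
    using S by (auto intro: open_image_fst convex_fst_image)
  obtain T1 where T1: "smooth_on (fst ` Q) T1" "\<And>z. z \<in> Q \<Longrightarrow> T z = T1 (fst z)"
    using smooth_on_descend[OF Q conv smooth(1)] time_fibre_preserving(2)
    by (auto simp: tot_u_def zero_prod_def)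
  have T1x: "pd_x T1 p = 0" if "p \<in> fst ` Q" for p
    using that tot_of_base(2)[OF Q _ T1] time_fibre_preserving(1) by force
  obtain \<tau> where \<tau>: "smooth_on (fst ` fst ` Q) \<tau>" "\<And>p. p \<in> fst ` Q \<Longrightarrow> T1 p = \<tau> (fst p)"
    using smooth_on_descend[OF S T1(1)] T1x smooth_on_pd_eq(2)[OF T1(1)] by auto
  have Tt: "tot_t T z = deriv \<tau> (fst (fst z))" if "z \<in> Q" for z
    using tot_of_base(1)[OF Q that T1] pd_of_time(1)[of "fst ` Q" "fst z" T1 \<tau>] S(1) \<tau>(2) that by auto
  obtain Y where Y: "smooth_on (fst ` Q) Y" "\<And>z. z \<in> Q \<Longrightarrow> X z = Y (fst z)"
    using smooth_on_descend[OF Q conv smooth(2)] space_fibre_preserving(1)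
    by (auto simp: tot_u_def zero_prod_def)
  have Xx: "tot_x X z = pd_x Y (fst z)" if "z \<in> Q" for z
    using tot_of_base(2)[OF Q that Y] .
  have Yx: "(pd_x Y p)\<^sup>2 = deriv \<tau> (fst p)" "pd_x Y p \<noteq> 0" if "p \<in> fst ` Q" for p
    using that space_fibre_preserving(2) space_derivative_nonzero Tt Xx by force+
  note smY = smooth_on_pd(2)[OF S(1) Y(1)]
  have Yxx: "pd_x (pd_x Y) p = 0" if p: "p \<in> fst ` Q" for p
  proof -
    obtain t x where tx: "p = (t, x)" by (cases p)
    have "pd_x (\<lambda>p. (pd_x Y p)\<^sup>2) p = 0"
      by (rule pd_of_time(2)[OF S(1) p]) (rule Yx(1))
    moreover have "((\<lambda>y. (pd_x Y (t, y))\<^sup>2) has_real_derivative 2 * pd_x Y p * pd_x (pd_x Y) p) (at x)"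
      using p tx by (auto intro!: derivative_eq_intros pd_x_has_real_derivative[OF smY])
    ultimately have "2 * pd_x Y p * pd_x (pd_x Y) p = 0"
      using DERIV_imp_deriv by (fastforce simp: pd_x_def[of "\<lambda>p. (pd_x Y p)\<^sup>2"] tx)
    then show ?thesis using Yx(2)[OF p] by simp
  qed
  obtain X1 where X1: "smooth_on (fst ` fst ` Q) X1" "\<And>p. p \<in> fst ` Q \<Longrightarrow> pd_x Y p = X1 (fst p)"
    using smooth_on_descend[OF S smY] Yxx smooth_on_pd_eq(2)[OF smY] by auto
  have smX1: "smooth_on (fst ` Q) (\<lambda>p. X1 (fst p))"
    by (rule smooth_on_compose[OF X1(1) S(1)]) (auto intro: smooth_intros S(1))
  have smd: "smooth_on (fst ` Q) (\<lambda>p. Y p - X1 (fst p) * snd p)"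
    by (intro smooth_on_diff smooth_on_mult smooth_on_snd smooth_on_ident S(1) Y(1) smX1)
  have "pd_x (\<lambda>p. Y p - X1 (fst p) * snd p) p = 0" if p: "p \<in> fst ` Q" for p
  proof -
    obtain t x where tx: "p = (t, x)" by (cases p)
    have "((\<lambda>y. Y (t, y) - X1 t * y) has_real_derivative pd_x Y p - X1 t * 1) (at x)"
      using p tx by (auto intro!: derivative_eq_intros pd_x_has_real_derivative[OF Y(1)])
    then show ?thesis
      using X1(2)[OF p] by (auto simp: pd_x_def[of "\<lambda>p. Y p - X1 (fst p) * snd p"] tx intro!: DERIV_imp_deriv)
  qed
  then have "frechet_derivative (\<lambda>p. Y p - X1 (fst p) * snd p) (at p) (0, 1) = 0" if "p \<in> fst ` Q" for p
    using smooth_on_pd_eq(2)[OF smd that] that by simp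
  then obtain X0 where X0: "smooth_on (fst ` fst ` Q) X0"
    "\<And>p. p \<in> fst ` Q \<Longrightarrow> Y p - X1 (fst p) * snd p = X0 (fst p)"
    by (rule smooth_on_descend[OF S smd]) (assumption, rule that, assumption, simp)
  have hX: "hess X z 0 b c = 0" if z: "z \<in> Q" for z b c
  proof -
    note d = tot_of_base[OF Q z smY Xx]
    have "tot_x (tot_x X) z = 0" "tot_u (tot_x X) z = 0"
      using d(2,3) Yxx z by auto
    then show ?thesis
      using frechet_derivative_zero_on[OF space_fibre_preserving(1) z]
      by (simp add: hess_def tot_t_def[of "tot_u X"] tot_x_def[of "tot_u X"] tot_u_def[of "tot_u X"])
  qed
  show ?thesis
  proof (rule that[OF \<tau>(1) X0(1) X1(1) _ hX])
    fix t x u assume z: "((t, x), u) \<in> Q"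
    then have p: "(t, x) \<in> fst ` Q" by force
    show "T ((t, x), u) = \<tau> t \<and> X ((t, x), u) = X1 t * x + X0 t \<and> X1 t \<noteq> 0 \<and> deriv \<tau> t = (X1 t)\<^sup>2"
      using T1(2)[OF z] \<tau>(2)[OF p] Y(2)[OF z] X0(2)[OF p] Yx[OF p] X1(2)[OF p] by simp
  qed
qed

text \<open>Keep f_xx = 0 and vary b = f_x. As f_t = B b is linear in b, the first-order relations
  make \<open>G\<close> and \<open>H\<close> affine in b. In the target equation only the Hessian of
  U can then contribute b^2, with coefficient T_t^2 U_uu, which must vanish.\<close>

lemma fibre_affine:
  assumes conv: "convex Q"
  obtains U0 U1 where "smooth_on (fst ` Q) U0" "smooth_on (fst ` Q) U1"
    "\<And>p u. (p, u) \<in> Q \<Longrightarrow> U (p, u) = U1 p * u + U0 p \<and> U1 p \<noteq> 0"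
proof -
  have Uu: "tot_u U z \<noteq> 0" and Uuu: "tot_u (tot_u U) z = 0" if z: "z \<in> Q" for z
  proof -
    obtain t x u where zt: "z = ((t, x), u)" by (metis surj_pair)
    note Xu = space_fibre_preserving(1)[OF z] and Tu = time_fibre_preserving[OF z]
    have hX: "hess X z 0 b c = 0" for b c
      by (rule space_affine[OF conv]) (simp add: z)
    define \<xi> where "\<xi> = tot_x X z"
    have "\<xi> \<noteq> 0" using space_derivative_nonzero[OF z] by (simp add: \<xi>_def)
    have "\<exists>H G. tot_t U z + B (t, x) * b * tot_u U z = H * tot_t T z + G * tot_t X z \<and>
        tot_x U z + b * tot_u U z = G * \<xi> \<and>
        H * (tot_t T z * \<xi>)\<^sup>2 = \<epsilon> * hess U z 0 (tot_t T z) (b * tot_t T z) + B' (T z, X z) * G * (tot_t T z * \<xi>)\<^sup>2" for b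
      by (rule reduced_equation[of t x u b 0, folded zt, OF z])
        (use \<open>\<xi> \<noteq> 0\<close> in \<open>simp add: Xu \<xi>_def\<close>, intro exI conjI, simp_all add: Xu hX \<xi>_def)
    then obtain H G where HG:
      "\<And>b. tot_t U z + B (t, x) * b * tot_u U z = H b * tot_t T z + G b * tot_t X z"
      "\<And>b. tot_x U z + b * tot_u U z = G b * \<xi>"
      "\<And>b. H b * (tot_t T z * \<xi>)\<^sup>2 = \<epsilon> * hess U z 0 (tot_t T z) (b * tot_t T z) + B' (T z, X z) * G b * (tot_t T z * \<xi>)\<^sup>2"
      by metis
    \<comment> \<open>As T_u = X_u = 0, the factor of \<open>characteristic_nonzero\<close> is U_u
      itself.\<close>
    have "tot_u U z - H 0 * tot_u T z - G 0 * tot_u X z \<noteq> 0"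
      using characteristic_nonzero[OF z, of 0 "H 0" "G 0" 0] HG(1,2)[of 0] by (simp add: Xu Tu \<xi>_def)
    then show "tot_u U z \<noteq> 0" by (simp add: Xu Tu)
    \<comment> \<open>Second differences at b = -1, 0, 1 kill affine functions of b and double the
      coefficient of b^2.\<close>
    have "(G 1 + G (- 1) - 2 * G 0) * \<xi> = 0"
      using HG(2)[of 1] HG(2)[of "- 1"] HG(2)[of 0] by (simp add: algebra_simps)
    then have G2: "G 1 + G (- 1) = 2 * G 0" using \<open>\<xi> \<noteq> 0\<close> by simp
    have "(H 1 + H (- 1) - 2 * H 0) * tot_t T z + (G 1 + G (- 1) - 2 * G 0) * tot_t X z = 0"
      using HG(1)[of 1] HG(1)[of "- 1"] HG(1)[of 0] by (simp add: algebra_simps)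
    then have H2: "H 1 + H (- 1) = 2 * H 0" using G2 time_derivative_nonzero[OF z] by simp
    have "hess U z 0 (tot_t T z) (1 * tot_t T z) + hess U z 0 (tot_t T z) (- 1 * tot_t T z)
        - 2 * hess U z 0 (tot_t T z) (0 * tot_t T z) = 2 * (tot_t T z)\<^sup>2 * tot_u (tot_u U) z"
      by (simp add: hess_def power2_eq_square algebra_simps)
    moreover have "\<epsilon> * (hess U z 0 (tot_t T z) (1 * tot_t T z) + hess U z 0 (tot_t T z) (- 1 * tot_t T z)
        - 2 * hess U z 0 (tot_t T z) (0 * tot_t T z)) =
        (H 1 + H (- 1) - 2 * H 0) * (tot_t T z * \<xi>)\<^sup>2 - B' (T z, X z) * (G 1 + G (- 1) - 2 * G 0) * (tot_t T z * \<xi>)\<^sup>2"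
      using HG(3)[of 1] HG(3)[of "- 1"] HG(3)[of 0] by (simp add: algebra_simps)
    ultimately have "\<epsilon> * (2 * (tot_t T z)\<^sup>2 * tot_u (tot_u U) z) = 0"
      unfolding G2 H2 by simp
    then show "tot_u (tot_u U) z = 0"
      using eps time_derivative_nonzero[OF z] by simp
  qed
  note smU = smooth_on_tot(3)[OF smooth(3)]
  have S: "open (fst ` Q)" using Q by (rule open_image_fst)
  obtain U1 where U1: "smooth_on (fst ` Q) U1" "\<And>z. z \<in> Q \<Longrightarrow> tot_u U z = U1 (fst z)"
    using smooth_on_descend[OF Q conv smU] Uuu by (auto simp: tot_u_def[of "tot_u U"] zero_prod_def)
  have smd: "smooth_on Q (\<lambda>z. U z - U1 (fst z) * snd z)"
    by (intro smooth_on_diff smooth_on_mult smooth_on_snd smooth_on_ident Q smooth(3)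
        smooth_on_compose[OF U1(1)] smooth_on_fst) simp
  have "tot_u (\<lambda>z. U z - U1 (fst z) * snd z) z = 0" if z: "z \<in> Q" for z
  proof -
    obtain p u where pu: "z = (p, u)" by (cases z)
    have "((\<lambda>v. U (p, v) - U1 p * v) has_real_derivative tot_u U z - U1 p * 1) (at u)"
      using z pu by (auto intro!: derivative_eq_intros tot_u_has_real_derivative[OF smooth(3)])
    moreover have "((\<lambda>v. U (p, v) - U1 p * v) has_real_derivative tot_u (\<lambda>z. U z - U1 (fst z) * snd z) z) (at u)"
      using tot_u_has_real_derivative[OF smd, of p u] z pu by simp
    ultimately show ?thesis
      using DERIV_unique U1(2)[OF z] pu by fastforce
  qed
  then have "frechet_derivative (\<lambda>z. U z - U1 (fst z) * snd z) (at z) (0, 1) = 0" if "z \<in> Q" for z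
    using that by (simp add: tot_u_def zero_prod_def)
  then obtain U0 where U0: "smooth_on (fst ` Q) U0" "\<And>z. z \<in> Q \<Longrightarrow> U z - U1 (fst z) * snd z = U0 (fst z)"
    by (rule smooth_on_descend[OF Q conv smd]) (assumption, rule that, assumption, simp)
  show ?thesis
  proof (rule that[OF U0(1) U1(1)])
    fix p u assume z: "(p, u) \<in> Q"
    show "U (p, u) = U1 p * u + U0 p \<and> U1 p \<noteq> 0"
      using U0(2)[OF z] U1(2)[OF z] Uu[OF z] by simp
  qed
qed

end

subsection \<open>Change of variables in the evolution operator\<close>

text \<open>At a given point the drift matters only by its value, so \<open>c\<close> is a number;
  drifts of different equations can be compared at one point without being extended to
  functions.\<close>

definition residual :: "real \<Rightarrow> real \<Rightarrow> (base \<Rightarrow> real) \<Rightarrow> base \<Rightarrow> real" where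
  "residual \<epsilon> c w p = pd_t w p - \<epsilon> * pd_x (pd_x w) p - c * pd_x w p"

lemma jet2_in_kolmogorov: "jet2 w p \<in> kolmogorov \<epsilon> B \<longleftrightarrow> residual \<epsilon> (B p) w p = 0"
  by (auto simp: jet2_def kolmogorov_def residual_def)

lemma residual_cong:
  assumes "open S" "p \<in> S" "\<And>p. p \<in> S \<Longrightarrow> f p = g p"
  shows "residual \<epsilon> c f p = residual \<epsilon> c g p"
  using pd_cong[OF assms] pd_cong(2)[OF assms(1,2) pd_cong(2)[OF assms(1) _ assms(3)]]
  by (simp add: residual_def)

lemma pd_mult:
  assumes "smooth_on S v" "smooth_on S w" "p \<in> S"
  shows "pd_t (\<lambda>p. v p * w p) p = pd_t v p * w p + v p * pd_t w p"
    and "pd_x (\<lambda>p. v p * w p) p = pd_x v p * w p + v p * pd_x w p"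
proof -
  obtain t x where p: "p = (t, x)" by (cases p)
  have "((\<lambda>s. v (s, x) * w (s, x)) has_real_derivative pd_t v p * w p + v p * pd_t w p) (at t)"
    using assms p by (auto intro!: derivative_eq_intros pd_t_has_real_derivative)
  then show "pd_t (\<lambda>p. v p * w p) p = pd_t v p * w p + v p * pd_t w p"
    by (simp add: pd_t_def[of "\<lambda>p. v p * w p"] p DERIV_imp_deriv)
  have "((\<lambda>y. v (t, y) * w (t, y)) has_real_derivative pd_x v p * w p + v p * pd_x w p) (at x)"
    using assms p by (auto intro!: derivative_eq_intros pd_x_has_real_derivative)
  then show "pd_x (\<lambda>p. v p * w p) p = pd_x v p * w p + v p * pd_x w p"
    by (simp add: pd_x_def[of "\<lambda>p. v p * w p"] p DERIV_imp_deriv)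
qed

lemma pd_add:
  assumes "smooth_on S v" "smooth_on S w" "p \<in> S"
  shows "pd_t (\<lambda>p. v p + w p) p = pd_t v p + pd_t w p"
    and "pd_x (\<lambda>p. v p + w p) p = pd_x v p + pd_x w p"
proof -
  obtain t x where p: "p = (t, x)" by (cases p)
  have "((\<lambda>s. v (s, x) + w (s, x)) has_real_derivative pd_t v p + pd_t w p) (at t)"
    using assms p by (auto intro!: derivative_eq_intros pd_t_has_real_derivative)
  then show "pd_t (\<lambda>p. v p + w p) p = pd_t v p + pd_t w p"
    by (simp add: pd_t_def[of "\<lambda>p. v p + w p"] p DERIV_imp_deriv)
  have "((\<lambda>y. v (t, y) + w (t, y)) has_real_derivative pd_x v p + pd_x w p) (at x)"
    using assms p by (auto intro!: derivative_eq_intros pd_x_has_real_derivative)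
  then show "pd_x (\<lambda>p. v p + w p) p = pd_x v p + pd_x w p"
    by (simp add: pd_x_def[of "\<lambda>p. v p + w p"] p DERIV_imp_deriv)
qed

lemma residual_add:
  assumes S: "open S" and vw: "smooth_on S v" "smooth_on S w" and p: "p \<in> S"
  shows "residual \<epsilon> c (\<lambda>p. v p + w p) p = residual \<epsilon> c v p + residual \<epsilon> c w p"
proof -
  note sm = smooth_on_pd(2)[OF S vw(1)] smooth_on_pd(2)[OF S vw(2)]
  have "pd_x (pd_x (\<lambda>p. v p + w p)) p = pd_x (\<lambda>p. pd_x v p + pd_x w p) p"
    by (rule pd_cong(2)[OF S p pd_add(2)[OF vw]])
  then show ?thesis
    by (simp add: residual_def pd_add[OF vw p] pd_add[OF sm p] algebra_simps)
qed

text \<open>The cross term stems from the second-order part of the operator and is the source of the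
  drift correction by U1.\<close>

lemma residual_mult:
  assumes S: "open S" and vw: "smooth_on S v" "smooth_on S w" and p: "p \<in> S"
  shows "residual \<epsilon> c (\<lambda>p. v p * w p) p =
    v p * residual \<epsilon> c w p + w p * residual \<epsilon> c v p - 2 * \<epsilon> * pd_x v p * pd_x w p"
proof -
  note sm = smooth_on_pd(2)[OF S vw(1)] smooth_on_pd(2)[OF S vw(2)]
  have "pd_x (pd_x (\<lambda>p. v p * w p)) p = pd_x (\<lambda>p. pd_x v p * w p + v p * pd_x w p) p"
    by (rule pd_cong(2)[OF S p pd_mult(2)[OF vw]])
  also have "\<dots> = pd_x (pd_x v) p * w p + pd_x v p * pd_x w p + (pd_x v p * pd_x w p + v p * pd_x (pd_x w) p)"
    using pd_add(2)[OF smooth_on_mult[OF S sm(1) vw(2)] smooth_on_mult[OF S vw(1) sm(2)] p]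
      pd_mult(2)[OF sm(1) vw(2) p] pd_mult(2)[OF vw(1) sm(2) p] by simp
  finally show ?thesis
    by (simp add: residual_def pd_mult[OF vw p] algebra_simps)
qed

lemma residual_const: "residual \<epsilon> c (\<lambda>p. k) p = 0"
  by (simp add: residual_def pd_t_def pd_x_def)

lemma pd_x_inverse_factor:
  assumes S: "open S" and U: "smooth_on S U" "\<And>p. p \<in> S \<Longrightarrow> U p \<noteq> 0" and p: "p \<in> S"
  shows "pd_x (\<lambda>p. 1 / U p) p = - (pd_x U p / U p) * (1 / U p)"
proof -
  have inv: "smooth_on S (\<lambda>p. 1 / U p)"
    by (rule smooth_on_divide[OF S smooth_on_const U])
  have "pd_x (\<lambda>p. 1 / U p) p * U p + 1 / U p * pd_x U p = pd_x (\<lambda>p. 1 / U p * U p) p"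
    using pd_mult(2)[OF inv U(1) p] by simp
  also have "\<dots> = pd_x (\<lambda>p. 1) p"
    by (rule pd_cong(2)[OF S p]) (use U(2) in auto)
  also have "\<dots> = 0" by (simp add: pd_x_def)
  finally show ?thesis using U(2)[OF p] by (simp add: field_simps)
qed

text \<open>A gauge change. For v = 1 / U the cross term of \<open>residual_mult\<close> is 2
  \<epsilon> (U_x / U) h_x / U, a first-order term in h that the drift absorbs. This is the origin
  of - 2 \<epsilon> U1_x / U1 in the relation between the drifts.\<close>

lemma residual_divide:
  assumes S: "open S" and U: "smooth_on S U" "\<And>p. p \<in> S \<Longrightarrow> U p \<noteq> 0" and h: "smooth_on S h" and p: "p \<in> S"
  shows "residual \<epsilon> c (\<lambda>p. h p / U p) p =
    residual \<epsilon> (c - 2 * \<epsilon> * (pd_x U p / U p)) h p / U p + h p * residual \<epsilon> c (\<lambda>p. 1 / U p) p"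
proof -
  have inv: "smooth_on S (\<lambda>p. 1 / U p)"
    by (rule smooth_on_divide[OF S smooth_on_const U])
  have "residual \<epsilon> c (\<lambda>p. h p / U p) p = residual \<epsilon> c (\<lambda>p. 1 / U p * h p) p" by simp
  also have "\<dots> = 1 / U p * residual \<epsilon> c h p + h p * residual \<epsilon> c (\<lambda>p. 1 / U p) p
      - 2 * \<epsilon> * pd_x (\<lambda>p. 1 / U p) p * pd_x h p"
    by (rule residual_mult[OF S inv h p])
  finally have "residual \<epsilon> c (\<lambda>p. h p / U p) p = 1 / U p * residual \<epsilon> c h p
      + h p * residual \<epsilon> c (\<lambda>p. 1 / U p) p + 2 * \<epsilon> * (pd_x U p / U p) * (1 / U p) * pd_x h p"
    by (simp add: pd_x_inverse_factor[OF S U p])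
  moreover have "residual \<epsilon> (c - 2 * \<epsilon> * (pd_x U p / U p)) h p
      = residual \<epsilon> c h p + 2 * \<epsilon> * (pd_x U p / U p) * pd_x h p"
    by (simp add: residual_def algebra_simps)
  ultimately show ?thesis
    by (simp add: add_divide_distrib algebra_simps)
qed

lemma smooth_on_deriv:
  fixes k :: "real \<Rightarrow> real"
  assumes "open I" "smooth_on I k"
  shows "t \<in> I \<Longrightarrow> (k has_real_derivative deriv k t) (at t)" "smooth_on I (deriv k)"
proof -
  have D: "(k has_real_derivative frechet_derivative k (at t) 1) (at t)" if "t \<in> I" for t
    using smooth_on_has_derivative[OF assms(2) that]
    by (metis has_derivative_imp_has_field_derivative has_derivative_linear linear_scale mult.right_neutral real_scaleR_def)
  then show "t \<in> I \<Longrightarrow> (k has_real_derivative deriv k t) (at t)"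
    by (metis DERIV_imp_deriv)
  show "smooth_on I (deriv k)"
    by (rule iffD2[OF smooth_on_cong[OF assms(1)] smooth_on_direction[OF assms(2), of 1]])
      (use D DERIV_imp_deriv in blast)
qed

text \<open>Here h_xx = X1^2 g_xx and h_t = T_t g_t + (X1_t x + X0_t) g_x, so T_t = X1^2 gives both
  leading terms the same factor. The remaining multiples of g_x are rewritten by h_x = X1 g_x and go
  into the drift, which explains the last term of the relation between the drifts.\<close>

lemma normal_form_pull_back:
  assumes W: "open W" "(t, x) \<in> W" and V: "open V" "smooth_on V g"
    and I: "open I" "fst ` W \<subseteq> I" and smooth: "smooth_on I T" "smooth_on I X0" "smooth_on I X1"
    and T: "deriv T t = (X1 t)\<^sup>2" and nz: "X1 t \<noteq> 0"
    and in_V: "\<And>t x. (t, x) \<in> W \<Longrightarrow> (T t, X1 t * x + X0 t) \<in> V"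
    and eq: "\<And>t x. (t, x) \<in> W \<Longrightarrow> g (T t, X1 t * x + X0 t) = h (t, x)"
  shows "residual \<epsilon> (X1 t * b + (deriv X1 t * x + deriv X0 t) / X1 t) h (t, x) =
    (X1 t)\<^sup>2 * residual \<epsilon> b g (T t, X1 t * x + X0 t)"
proof -
  have tI: "t \<in> I" if "(t, x) \<in> W" for t x using I(2) that by force
  note d = smooth_on_deriv(1)[OF I(1)]
  have ht: "pd_t h (t, x) = pd_t g (T t, X1 t * x + X0 t) * (X1 t)\<^sup>2
      + pd_x g (T t, X1 t * x + X0 t) * (deriv X1 t * x + deriv X0 t)"
  proof -
    have "pd_t h (t, x) = pd_t (\<lambda>p. g (T (fst p), X1 (fst p) * snd p + X0 (fst p))) (t, x)"
      by (rule pd_cong(1)[OF W]) (use eq in auto)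
    also have "\<dots> = pd_t g (T t, X1 t * x + X0 t) * deriv T t
      + pd_x g (T t, X1 t * x + X0 t) * (deriv X1 t * x + deriv X0 t)"
      unfolding pd_t_def[of "\<lambda>p. g (T (fst p), X1 (fst p) * snd p + X0 (fst p))"] fst_conv snd_conv
      by (rule DERIV_imp_deriv, rule smooth_on_pd_chain[OF V(2), where P = T and X = "\<lambda>s. X1 s * x + X0 s" and s = t])
        (auto intro!: derivative_eq_intros d[OF smooth(1)] d[OF smooth(2)] d[OF smooth(3)] tI[OF W(2)]
          in_V[OF W(2)])
    finally show ?thesis by (simp add: T)
  qed
  have space: "pd_x (\<lambda>p. k (T (fst p), X1 (fst p) * snd p + X0 (fst p))) (t, x) =
      pd_x k (T t, X1 t * x + X0 t) * X1 t" if k: "smooth_on V k" and tx: "(t, x) \<in> W" for k t x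
    unfolding pd_x_def[of "\<lambda>p. k (T (fst p), X1 (fst p) * snd p + X0 (fst p))"] fst_conv snd_conv
    by (rule DERIV_imp_deriv, rule DERIV_cong[OF smooth_on_pd_chain[OF k,
          where P = "\<lambda>_. T t" and X = "\<lambda>y. X1 t * y + X0 t" and s = x]])
      (auto intro!: derivative_eq_intros in_V[OF tx])
  have hx: "pd_x h p = pd_x g (T (fst p), X1 (fst p) * snd p + X0 (fst p)) * X1 (fst p)" if p: "p \<in> W" for p
  proof -
    have "pd_x h p = pd_x (\<lambda>p. g (T (fst p), X1 (fst p) * snd p + X0 (fst p))) p"
      by (rule pd_cong(2)[OF W(1) p]) (use eq in auto)
    then show ?thesis using space[OF V(2), of "fst p" "snd p"] p by simp
  qed
  have hxx: "pd_x (pd_x h) (t, x) = pd_x (pd_x g) (T t, X1 t * x + X0 t) * (X1 t)\<^sup>2"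
  proof -
    have sm: "smooth_on W (\<lambda>p. pd_x g (T (fst p), X1 (fst p) * snd p + X0 (fst p)))"
      "smooth_on W (\<lambda>p. X1 (fst p))"
    proof -
      have fst: "smooth_on W (\<lambda>p. k (fst p))" if "smooth_on I k" for k :: "real \<Rightarrow> real"
        by (rule smooth_on_compose[OF that W(1) smooth_on_fst[OF W(1) smooth_on_ident] I(2)])
      then show "smooth_on W (\<lambda>p. X1 (fst p))" using smooth(3) by simp
      have "smooth_on W (\<lambda>p. (T (fst p), X1 (fst p) * snd p + X0 (fst p)))"
        by (intro smooth_on_Pair smooth_on_add smooth_on_mult smooth_on_snd smooth_on_ident W(1) fst smooth)
      then show "smooth_on W (\<lambda>p. pd_x g (T (fst p), X1 (fst p) * snd p + X0 (fst p)))"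
        by (rule smooth_on_compose[OF smooth_on_pd(2)[OF V] W(1)]) (use in_V in auto)
    qed
    have "pd_x (pd_x h) (t, x) = pd_x (\<lambda>p. pd_x g (T (fst p), X1 (fst p) * snd p + X0 (fst p)) * X1 (fst p)) (t, x)"
      by (rule pd_cong(2)[OF W hx])
    also have "\<dots> = pd_x (pd_x g) (T t, X1 t * x + X0 t) * X1 t * X1 t"
      using pd_mult(2)[OF sm W(2)] space[OF smooth_on_pd(2)[OF V] W(2)] by (simp add: pd_x_def[of "\<lambda>p. X1 (fst p)"])
    finally show ?thesis by (simp add: power2_eq_square)
  qed
  show ?thesis
    using nz hx[OF W(2)] by (simp add: residual_def ht hxx power2_eq_square field_simps)
qed

subsection \<open>Necessity and sufficiency\<close>

context kolmogorov_map
begin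

lemma normal_form:
  assumes conv: "convex Q"
  shows "\<exists>\<tau> X0 X1 U0 U1. has_components \<epsilon> B Q (\<lambda>z. ((T z, X z), U z)) \<tau> X0 X1 U0 U1 \<and>
    (\<forall>t x. (t, x) \<in> fst ` Q \<longrightarrow> B' (\<tau> t, X1 t * x + X0 t) =
      1 / X1 t * (B (t, x) - 2 * \<epsilon> * (pd_x U1 (t, x) / U1 (t, x)))
      - (deriv X1 t * x + deriv X0 t) / (X1 t)\<^sup>2)"
proof -
  define S where "S = fst ` Q"
  have S: "open S" using Q by (auto simp: S_def intro: open_image_fst)
  have I: "open (fst ` S)" using S by (rule open_image_fst)
  obtain \<tau> X0 X1 where smT: "smooth_on (fst ` S) \<tau>" "smooth_on (fst ` S) X0" "smooth_on (fst ` S) X1"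
    and TX: "\<And>t x u. ((t, x), u) \<in> Q \<Longrightarrow> T ((t, x), u) = \<tau> t \<and> X ((t, x), u) = X1 t * x + X0 t \<and>
      X1 t \<noteq> 0 \<and> deriv \<tau> t = (X1 t)\<^sup>2"
    unfolding S_def by (rule space_affine[OF conv]) blast
  obtain U0 U1 where smU: "smooth_on S U0" "smooth_on S U1"
    and UU: "\<And>p u. (p, u) \<in> Q \<Longrightarrow> U (p, u) = U1 p * u + U0 p \<and> U1 p \<noteq> 0"
    unfolding S_def by (rule fibre_affine[OF conv]) blast
  \<comment> \<open>The drift felt by the pull-back h = U1 f + U0 of g, from
    \<open>normal_form_pull_back\<close> with b the value of \<open>B'\<close>. The claimed relation
    is C = B - 2 \<epsilon> U1_x / U1 solved for that value.\<close>
  define C where "C t x = X1 t * B' (\<tau> t, X1 t * x + X0 t) + (deriv X1 t * x + deriv X0 t) / X1 t" for t x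
  \<comment> \<open>Test functions with f_xx = 0, f_x = b and f_t = B b. The left side is affine in
    b and in u: the coefficient of b determines C, that of u and the remainder say that U1 and U0
    satisfy the equation with drift C.\<close>
  have key: "u * residual \<epsilon> (C t x) U1 (t, x) + residual \<epsilon> (C t x) U0 (t, x)
      + b * (U1 (t, x) * (B (t, x) - C t x) - 2 * \<epsilon> * pd_x U1 (t, x)) = 0"
    if z: "((t, x), u) \<in> Q" for t x u b
  proof -
    define f where "f = quadratic t x u (B (t, x) * b) b 0 0"
    have jf: "jet2 f (t, x) = ((t, x), u, B (t, x) * b, b, 0, 0, 0)"
      unfolding f_def by (rule jet2_quadratic)
    then have f0: "f (t, x) = u" "pd_t f (t, x) = B (t, x) * b" "pd_x f (t, x) = b" "pd_x (pd_x f) (t, x) = 0"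
      by (auto simp: jet2_def)
    have smf: "smooth_on UNIV f" unfolding f_def by (rule smooth_on_quadratic)
    have zf: "((t, x), f (t, x)) \<in> Q" using z by (simp add: f0)
    have J: "(tot_t T ((t, x), f (t, x)) + tot_u T ((t, x), f (t, x)) * pd_t f (t, x))
        * (tot_x X ((t, x), f (t, x)) + tot_u X ((t, x), f (t, x)) * pd_x f (t, x))
        - (tot_x T ((t, x), f (t, x)) + tot_u T ((t, x), f (t, x)) * pd_x f (t, x))
        * (tot_t X ((t, x), f (t, x)) + tot_u X ((t, x), f (t, x)) * pd_t f (t, x)) \<noteq> 0"
      using time_derivative_nonzero[OF zf] space_derivative_nonzero[OF zf]
      by (simp add: time_fibre_preserving[OF zf] space_fibre_preserving(1)[OF zf])
    obtain W V g where W: "open W" "(t, x) \<in> W" "\<And>p. p \<in> W \<Longrightarrow> (p, f p) \<in> Q" and V: "open V" "smooth_on V g"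
      and g: "\<And>p. p \<in> W \<Longrightarrow> (T (p, f p), X (p, f p)) \<in> V"
      "\<And>p. p \<in> W \<Longrightarrow> g (T (p, f p), X (p, f p)) = U (p, f p)"
      and pair: "(jet2 f (t, x), jet2 g (T ((t, x), f (t, x)), X ((t, x), f (t, x))))
        \<in> prolong2 Q (\<lambda>z. ((T z, X z), U z))"
      by (rule prolong2_pair_exists[OF Q smooth smf zf J]) blast
    have WS: "W \<subseteq> S" using W(3) by (force simp: S_def)
    have TXf: "T ((t, x), f (t, x)) = \<tau> t" "X ((t, x), f (t, x)) = X1 t * x + X0 t"
      "U ((t, x), f (t, x)) = U1 (t, x) * f (t, x) + U0 (t, x)" "X1 t \<noteq> 0" "deriv \<tau> t = (X1 t)\<^sup>2"
      if "(t, x) \<in> W" for t x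
      using TX[OF W(3)[OF that]] UU[OF W(3)[OF that]] by auto
    have "jet2 g (\<tau> t, X1 t * x + X0 t) \<in> kolmogorov \<epsilon> B'"
      using maps[OF pair] by (simp add: jf TXf[OF W(2)] kolmogorov_def)
    then have g0: "residual \<epsilon> (B' (\<tau> t, X1 t * x + X0 t)) g (\<tau> t, X1 t * x + X0 t) = 0"
      by (simp add: jet2_in_kolmogorov)
    have "residual \<epsilon> (C t x) (\<lambda>p. U1 p * f p + U0 p) (t, x) = (X1 t)\<^sup>2 *
        residual \<epsilon> (B' (\<tau> t, X1 t * x + X0 t)) g (\<tau> t, X1 t * x + X0 t)"
      unfolding C_def
    proof (rule normal_form_pull_back[OF W(1,2) V I _ smT TXf(5,4)[OF W(2)]])
      show "fst ` W \<subseteq> fst ` S" using WS by blast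
      fix t x assume tx: "(t, x) \<in> W"
      show "(\<tau> t, X1 t * x + X0 t) \<in> V" "g (\<tau> t, X1 t * x + X0 t) = U1 (t, x) * f (t, x) + U0 (t, x)"
        using g[OF tx] TXf[OF tx] by simp_all
    qed
    then have "residual \<epsilon> (C t x) (\<lambda>p. U1 p * f p + U0 p) (t, x) = 0"
      by (simp add: g0)
    moreover have p: "(t, x) \<in> S" using WS W(2) by blast
    note smf' = smooth_on_subset[OF smf subset_UNIV, of S]
    ultimately have "U1 (t, x) * residual \<epsilon> (C t x) f (t, x) + f (t, x) * residual \<epsilon> (C t x) U1 (t, x)
        - 2 * \<epsilon> * pd_x U1 (t, x) * pd_x f (t, x) + residual \<epsilon> (C t x) U0 (t, x) = 0"
      using residual_add[OF S smooth_on_mult[OF S smU(2) smf'] smU(1) p] residual_mult[OF S smU(2) smf' p]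
      by simp
    then show ?thesis
      by (simp add: residual_def[of _ _ f] f0 algebra_simps)
  qed
  have eqs: "C t x = B (t, x) - 2 * \<epsilon> * (pd_x U1 (t, x) / U1 (t, x))"
    "residual \<epsilon> (C t x) U1 (t, x) = 0" "residual \<epsilon> (C t x) U0 (t, x) = 0" "U1 (t, x) \<noteq> 0" "X1 t \<noteq> 0"
    "deriv \<tau> t = (X1 t)\<^sup>2" if p: "(t, x) \<in> S" for t x
  proof -
    obtain u where z: "((t, x), u) \<in> Q" using p by (auto simp: S_def)
    show nz: "U1 (t, x) \<noteq> 0" "X1 t \<noteq> 0" "deriv \<tau> t = (X1 t)\<^sup>2" using UU[OF z] TX[OF z] by auto
    have "U1 (t, x) * (B (t, x) - C t x) - 2 * \<epsilon> * pd_x U1 (t, x) = 0"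
      using key[OF z, of 0] key[OF z, of 1] by simp
    then show "C t x = B (t, x) - 2 * \<epsilon> * (pd_x U1 (t, x) / U1 (t, x))"
      using nz by (simp add: field_simps)
    \<comment> \<open>Separating U1 from U0 takes two heights over the same (t, x), which openness
      of Q supplies.\<close>
    have "open ((\<lambda>v. ((t, x), v)) -` Q)"
      by (rule open_vimage[OF Q]) (intro continuous_on_Pair continuous_on_id continuous_on_const)
    then obtain d where d: "d > 0" "ball u d \<subseteq> (\<lambda>v. ((t, x), v)) -` Q"
      using z by (force simp: open_contains_ball)
    then have "u + d / 2 \<in> (\<lambda>v. ((t, x), v)) -` Q"
      by (intro subsetD[OF d(2)]) (simp add: dist_real_def)
    then have "((t, x), u + d / 2) \<in> Q" by simp
    note k = key[OF z, of 0] key[OF this, of 0]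
    have "d / 2 * residual \<epsilon> (C t x) U1 (t, x) =
        ((u + d / 2) * residual \<epsilon> (C t x) U1 (t, x) + residual \<epsilon> (C t x) U0 (t, x))
        - (u * residual \<epsilon> (C t x) U1 (t, x) + residual \<epsilon> (C t x) U0 (t, x))"
      by (simp add: algebra_simps)
    also have "\<dots> = 0" using k by simp
    finally have "d / 2 * residual \<epsilon> (C t x) U1 (t, x) = 0" .
    then show "residual \<epsilon> (C t x) U1 (t, x) = 0" using d(1) by simp
    then show "residual \<epsilon> (C t x) U0 (t, x) = 0" using k(1) by simp
  qed
  have nzU: "U1 p \<noteq> 0" if "p \<in> S" for p using eqs(4)[of "fst p" "snd p"] that by simp
  have sol: "residual \<epsilon> (B p) (\<lambda>p. 1 / U1 p) p = 0" "residual \<epsilon> (B p) (\<lambda>p. U0 p / U1 p) p = 0" if p: "p \<in> S" for p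
  proof -
    note e = eqs[of "fst p" "snd p", simplified, OF p]
    \<comment> \<open>Constants have zero residual for every drift; reading 1 as U1 / U1 in
      \<open>residual_divide\<close> isolates the residual of 1 / U1.\<close>
    have "residual \<epsilon> (B p) (\<lambda>p. U1 p / U1 p) p = residual \<epsilon> (B p) (\<lambda>p. 1) p"
      by (rule residual_cong[OF S p]) (use nzU in auto)
    then show 1: "residual \<epsilon> (B p) (\<lambda>p. 1 / U1 p) p = 0"
      using residual_divide[OF S smU(2) nzU smU(2) p, of \<epsilon> "B p"] e by (simp add: residual_const)
    show "residual \<epsilon> (B p) (\<lambda>p. U0 p / U1 p) p = 0"
      using residual_divide[OF S smU(2) nzU smU(1) p, of \<epsilon> "B p"] e 1 by simp
  qed
  have smd: "smooth_on S (\<lambda>p. 1 / U1 p)" "smooth_on S (\<lambda>p. U0 p / U1 p)"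
    using nzU by (auto intro!: smooth_on_divide S smooth_on_const smU)
  have "has_components \<epsilon> B Q (\<lambda>z. ((T z, X z), U z)) \<tau> X0 X1 U0 U1"
    unfolding has_components_def S_def[symmetric] solves_def jet2_in_kolmogorov
    using smT smU TX UU eqs(5,6) nzU sol smd by auto
  moreover have "B' (\<tau> t, X1 t * x + X0 t) = 1 / X1 t * (B (t, x) - 2 * \<epsilon> * (pd_x U1 (t, x) / U1 (t, x)))
      - (deriv X1 t * x + deriv X0 t) / (X1 t)\<^sup>2" if p: "(t, x) \<in> S" for t x
    unfolding eqs(1)[OF p, symmetric] C_def using eqs(5)[OF p] by (simp add: field_simps power2_eq_square)
  ultimately show ?thesis
    unfolding S_def by blast
qed

end

text \<open>Write f = h / U1 - U0 / U1, where h = U1 f + U0 is the pull-back of g. As 1 / U1 and U0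
  / U1 are solutions, the residual of f is X1^2 / U1 times that of g; the factor is nonzero, so both
  implications come at once. Just the point (p, f p) is placed in Q, because the theorem applies
  this on a ball that the graph may leave.\<close>

lemma has_components_equation_iff:
  assumes comp: "has_components \<epsilon> B Q \<Phi> T X0 X1 U0 U1" and Q: "open Q"
    and B': "\<And>t x. (t, x) \<in> fst ` Q \<Longrightarrow> B' (T t, X1 t * x + X0 t) =
      1 / X1 t * (B (t, x) - 2 * \<epsilon> * (pd_x U1 (t, x) / U1 (t, x)))
      - (deriv X1 t * x + deriv X0 t) / (X1 t)\<^sup>2"
    and f: "open N" "p \<in> N" "smooth_on N f" and g: "open V" "smooth_on V g"
    and graph: "\<Phi> ` graph_on N f = graph_on V g" "\<Phi> (p, f p) = (q, g q)" and p: "(p, f p) \<in> Q"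
  shows "jet2 f p \<in> kolmogorov \<epsilon> B \<longleftrightarrow> jet2 g q \<in> kolmogorov \<epsilon> B'"
proof -
  obtain t x where tx: "p = (t, x)" by (cases p)
  define S where "S = fst ` Q"
  have S: "open S" using Q by (auto simp: S_def intro: open_image_fst)
  have I: "open (fst ` S)" using S by (rule open_image_fst)
  note comp = comp[unfolded has_components_def S_def[symmetric]]
  have sm: "smooth_on (fst ` S) T" "smooth_on (fst ` S) X0" "smooth_on (fst ` S) X1" "smooth_on S U0" "smooth_on S U1"
    using comp by auto
  have \<Phi>: "\<Phi> ((t, x), u) = ((T t, X1 t * x + X0 t), U1 (t, x) * u + U0 (t, x))" if "((t, x), u) \<in> Q" for t x u
    using comp that by blast
  define W where "W = N \<inter> (\<lambda>p. (p, f p)) -` Q"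
  have "continuous_on N (\<lambda>p. (p, f p))"
    by (intro continuous_on_Pair continuous_on_id smooth_on_imp_continuous_on f)
  then have W: "open W" "(t, x) \<in> W"
    using f(1,2) p Q tx by (auto simp: W_def intro: continuous_open_preimage)
  have WN: "W \<subseteq> N" and WS: "W \<subseteq> S" by (auto simp: W_def S_def intro!: image_eqI)
  have on_graph: "(T t, X1 t * x + X0 t) \<in> V \<and> g (T t, X1 t * x + X0 t) = U1 (t, x) * f (t, x) + U0 (t, x)"
    if "(t, x) \<in> W" for t x
  proof -
    have "\<Phi> ((t, x), f (t, x)) \<in> graph_on V g"
      unfolding graph(1)[symmetric] using that by (auto simp: W_def graph_on_def)
    moreover have "((t, x), f (t, x)) \<in> Q" using that by (simp add: W_def)
    ultimately show ?thesis by (auto simp: \<Phi> graph_on_def)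
  qed
  have pS: "(t, x) \<in> S" using W(2) WS by blast
  have q: "q = (T t, X1 t * x + X0 t)" using graph(2) \<Phi> p tx by simp
  have nz: "X1 t \<noteq> 0" "U1 (t, x) \<noteq> 0" "deriv T t = (X1 t)\<^sup>2"
    using comp pS by auto
  have nzU: "U1 p \<noteq> 0" if "p \<in> S" for p using comp that by blast
  define h where "h p = U1 p * f p + U0 p" for p
  define c where "c = X1 t * B' q + (deriv X1 t * x + deriv X0 t) / X1 t"
  have c: "c = B (t, x) - 2 * \<epsilon> * (pd_x U1 (t, x) / U1 (t, x))"
  proof -
    have "k * (1 / k * r - m / k\<^sup>2) + m / k = r" if "k \<noteq> 0" for k r m :: real
      using that by (simp add: field_simps power2_eq_square)
    then show ?thesis
      unfolding c_def q B'[OF pS[unfolded S_def]] using nz(1) by blast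
  qed
  have smf: "smooth_on W f" using f(3) WN by (rule smooth_on_subset)
  have smU: "smooth_on W U0" "smooth_on W U1" using sm(4,5) WS by (auto intro: smooth_on_subset)
  have smh: "smooth_on W h"
    unfolding h_def by (intro smooth_on_add smooth_on_mult W(1) smf smU)
  have nzW: "U1 p \<noteq> 0" if "p \<in> W" for p using nzU that WS by blast
  have smq: "smooth_on W (\<lambda>p. U0 p / U1 p)"
    by (intro smooth_on_divide W(1) smU nzW)
  have sol: "residual \<epsilon> (B (t, x)) (\<lambda>p. 1 / U1 p) (t, x) = 0" "residual \<epsilon> (B (t, x)) (\<lambda>p. U0 p / U1 p) (t, x) = 0"
    using comp pS unfolding solves_def jet2_in_kolmogorov by auto
  have "residual \<epsilon> c h (t, x) = (X1 t)\<^sup>2 * residual \<epsilon> (B' q) g q"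
    unfolding c_def q
    by (rule normal_form_pull_back[OF W g I _ sm(1-3) nz(3,1)])
      (use on_graph WS in \<open>auto simp: h_def\<close>)
  moreover have "residual \<epsilon> (B (t, x)) (\<lambda>p. h p / U1 p) (t, x) = residual \<epsilon> c h (t, x) / U1 (t, x)"
    using residual_divide[OF W(1) smU(2) nzW smh W(2), of \<epsilon> "B (t, x)"] sol(1) by (simp add: c)
  moreover have "residual \<epsilon> (B (t, x)) (\<lambda>p. h p / U1 p) (t, x) =
      residual \<epsilon> (B (t, x)) (\<lambda>p. f p + U0 p / U1 p) (t, x)"
    by (rule residual_cong[OF W]) (use nzW in \<open>simp add: h_def field_simps\<close>)
  moreover have "\<dots> = residual \<epsilon> (B (t, x)) f (t, x)"
    using residual_add[OF W(1) smf smq W(2)] sol(2) by simp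
  ultimately have "residual \<epsilon> (B (t, x)) f (t, x) = (X1 t)\<^sup>2 * residual \<epsilon> (B' q) g q / U1 (t, x)"
    by simp
  then show ?thesis
    using nz by (simp add: jet2_in_kolmogorov tx)
qed

text \<open>An equivalence for each related pair is stronger than equality of images: \<Phi> need
  not be injective, so one target jet may come from several source jets.\<close>

lemma connectsI:
  assumes "\<And>N p f V q g. open N \<Longrightarrow> p \<in> N \<Longrightarrow> smooth_on N f \<Longrightarrow> graph_on N f \<subseteq> \<Omega> \<Longrightarrow>
    open V \<Longrightarrow> smooth_on V g \<Longrightarrow> \<Phi> ` graph_on N f = graph_on V g \<Longrightarrow> \<Phi> (p, f p) = (q, g q) \<Longrightarrow>
    jet2 f p \<in> kolmogorov \<epsilon> B \<longleftrightarrow> jet2 g q \<in> kolmogorov \<epsilon> B'"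
  shows "connects \<epsilon> \<Omega> \<Phi> B B'"
proof -
  have "j \<in> kolmogorov \<epsilon> B \<longleftrightarrow> j' \<in> kolmogorov \<epsilon> B'" if "(j, j') \<in> prolong2 \<Omega> \<Phi>" for j j'
    using that assms unfolding prolong2_def by blast
  then show ?thesis
    unfolding connects_def by blast
qed

lemma prolong2_mono:
  assumes "Q \<subseteq> \<Omega>"
  shows "prolong2 Q \<Phi> \<subseteq> prolong2 \<Omega> \<Phi>"
proof
  fix z assume "z \<in> prolong2 Q \<Phi>"
  then obtain f N p g V q where z: "z = (jet2 f p, jet2 g q)" "open N" "p \<in> N" "smooth_on N f"
    and sub: "graph_on N f \<subseteq> Q"
    and g: "open V" "q \<in> V" "smooth_on V g" "\<Phi> ` graph_on N f = graph_on V g" "\<Phi> (p, f p) = (q, g q)"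
    unfolding prolong2_def by blast
  have "graph_on N f \<subseteq> \<Omega>" using sub assms by blast
  with z g show "z \<in> prolong2 \<Omega> \<Phi>"
    unfolding prolong2_def by blast
qed

text \<open>\<Omega> carries the regularity of \<Phi> and \<Omega>' the pushforward, so that both
  halves of the theorem are served, with \<Omega>' = \<Omega> and with \<Omega>' = Q. Restriction to
  Q keeps the inclusion of the image in the target equation, which is what \<open>maps\<close> asks
  for.\<close>

lemma connects_normal_form:
  assumes eps: "\<epsilon> \<in> {-1, 1}" and pt: "point_transformation \<Omega> \<Phi>" and con: "connects \<epsilon> \<Omega>' \<Phi> B B'"
    and Q: "open Q" "convex Q" "Q \<subseteq> \<Omega>" "Q \<subseteq> \<Omega>'"
  shows "\<exists>T X0 X1 U0 U1. has_components \<epsilon> B Q \<Phi> T X0 X1 U0 U1 \<and>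
    (\<forall>t x. (t, x) \<in> fst ` Q \<longrightarrow> B' (T t, X1 t * x + X0 t) =
      1 / X1 t * (B (t, x) - 2 * \<epsilon> * (pd_x U1 (t, x) / U1 (t, x)))
      - (deriv X1 t * x + deriv X0 t) / (X1 t)\<^sup>2)"
proof -
  define T X U where "T z = fst (fst (\<Phi> z))" and "X z = snd (fst (\<Phi> z))" and "U z = snd (\<Phi> z)" for z
  have \<Phi>: "(\<lambda>z. ((T z, X z), U z)) = \<Phi>"
    by (simp add: T_def X_def U_def)
  have sm\<Phi>: "smooth_on Q \<Phi>"
    using point_transformation_smooth(2)[OF pt] Q(3) by (rule smooth_on_subset)
  have sm: "smooth_on Q T" "smooth_on Q X" "smooth_on Q U"
    unfolding T_def X_def U_def by (intro smooth_on_fst smooth_on_snd Q(1) sm\<Phi>)+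
  have "kolmogorov_map \<epsilon> Q T X U B B'"
  proof
    show "\<epsilon> \<noteq> 0" using eps by auto
    show "open Q" "smooth_on Q T" "smooth_on Q X" "smooth_on Q U" by (rule Q(1) sm)+
    show "j' \<in> kolmogorov \<epsilon> B'"
      if "(j, j') \<in> prolong2 Q (\<lambda>z. ((T z, X z), U z))" "j \<in> kolmogorov \<epsilon> B" for j j'
    proof -
      have "(j, j') \<in> prolong2 \<Omega>' \<Phi>"
        using that(1) prolong2_mono[OF Q(4)] unfolding \<Phi> by (rule subsetD[rotated])
      then show ?thesis
        using con that(2) unfolding connects_def by blast
    qed
    fix z l m n
    assume z: "z \<in> Q" and 0: "l * tot_t T z + m * tot_t X z + n * tot_t U z = 0"
      "l * tot_x T z + m * tot_x X z + n * tot_x U z = 0" "l * tot_u T z + m * tot_u X z + n * tot_u U z = 0"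
    let ?D = "frechet_derivative \<Phi> (at z)"
    have D: "(\<Phi> has_derivative ?D) (at z)" using smooth_on_has_derivative[OF sm\<Phi> z] .
    have DT: "frechet_derivative T (at z) = (\<lambda>v. fst (fst (?D v)))"
      unfolding T_def[abs_def]
      by (rule frechet_derivative_at[OF has_derivative_fst[OF has_derivative_fst[OF D]], symmetric])
    have DX: "frechet_derivative X (at z) = (\<lambda>v. snd (fst (?D v)))"
      unfolding X_def[abs_def]
      by (rule frechet_derivative_at[OF has_derivative_snd[OF has_derivative_fst[OF D]], symmetric])
    have DU: "frechet_derivative U (at z) = (\<lambda>v. snd (?D v))"
      unfolding U_def[abs_def]
      by (rule frechet_derivative_at[OF has_derivative_snd[OF D], symmetric])
    \<comment> \<open>The functional (l, m, n) vanishes on the range of the differential, which is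
      the whole space.\<close>
    have ann: "l * fst (fst (?D v)) + m * snd (fst (?D v)) + n * snd (?D v) = 0" for v
    proof -
      obtain a b c where v: "v = ((a, b), c)" by (metis surj_pair)
      have "l * fst (fst (?D v)) + m * snd (fst (?D v)) + n * snd (?D v) =
          a * (l * tot_t T z + m * tot_t X z + n * tot_t U z) +
          b * (l * tot_x T z + m * tot_x X z + n * tot_x U z) +
          c * (l * tot_u T z + m * tot_u X z + n * tot_u U z)"
        using frechet_derivative_tot[OF sm(1) z, of a b c] frechet_derivative_tot[OF sm(2) z, of a b c]
          frechet_derivative_tot[OF sm(3) z, of a b c] by (simp add: DT DX DU v algebra_simps)
      then show ?thesis using 0 by simp
    qed
    have "surj ?D" using point_transformation_surj[OF pt] z Q(3) by blast
    then have "l * fst (fst w) + m * snd (fst w) + n * snd w = 0" for w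
    proof -
      obtain v where "w = ?D v" using \<open>surj ?D\<close> by (rule surjE)
      then show ?thesis using ann[of v] by simp
    qed
    from this[of "((1, 0), 0)"] this[of "((0, 1), 0)"] this[of "((0, 0), 1)"]
    show "l = 0 \<and> m = 0 \<and> n = 0" by simp
  qed
  from kolmogorov_map.normal_form[OF this Q(2)] show ?thesis
    unfolding \<Phi> .
qed

text \<open>The relation prescribes \<open>B'\<close> along p -> (T, X), so this map must be
  injective on the whole projection of Q. T is strictly increasing, since T_t = X1^2 > 0 on an
  interval, and for fixed t the map is affine in x with slope X1. Smoothness of \<open>B'\<close> is
  local and comes from the smooth local inverses.\<close>

lemma target_drift_exists:
  fixes \<Phi> :: "total \<Rightarrow> total"
  assumes comp: "has_components \<epsilon> B Q \<Phi> T X0 X1 U0 U1" and Q: "open Q" "convex Q"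
    and B: "smooth_on (fst ` Q) B"
  obtains B' where "smooth_on (fst ` \<Phi> ` Q) B'"
    "\<And>t x. (t, x) \<in> fst ` Q \<Longrightarrow> B' (T t, X1 t * x + X0 t) =
      1 / X1 t * (B (t, x) - 2 * \<epsilon> * (pd_x U1 (t, x) / U1 (t, x)))
      - (deriv X1 t * x + deriv X0 t) / (X1 t)\<^sup>2"
proof -
  define S where "S = fst ` Q"
  have S: "open S" "convex S" using Q by (auto simp: S_def intro: open_image_fst convex_fst_image)
  have I: "open (fst ` S)" "convex (fst ` S)" using S by (auto intro: open_image_fst convex_fst_image)
  note comp = comp[unfolded has_components_def S_def[symmetric]]
  have sm: "smooth_on (fst ` S) T" "smooth_on (fst ` S) X0" "smooth_on (fst ` S) X1" "smooth_on S U1"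
    using comp by auto
  have \<Phi>: "\<Phi> ((t, x), u) = ((T t, X1 t * x + X0 t), U1 (t, x) * u + U0 (t, x))" if "((t, x), u) \<in> Q" for t x u
    using comp that by blast
  have nz: "X1 t \<noteq> 0" and T': "deriv T t = (X1 t)\<^sup>2" if "t \<in> fst ` S" for t
    using comp that by blast+
  have nzU: "U1 p \<noteq> 0" if "p \<in> S" for p using comp that by blast
  define \<phi> where "\<phi> p = (T (fst p), X1 (fst p) * snd p + X0 (fst p))" for p
  have smt: "smooth_on S (\<lambda>p. k (fst p))" if "smooth_on (fst ` S) k" for k :: "real \<Rightarrow> real"
    by (rule smooth_on_compose[OF that S(1) smooth_on_fst[OF S(1) smooth_on_ident]]) auto
  have smX: "smooth_on S (\<lambda>p. X1 (fst p) * snd p + X0 (fst p))"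
    by (intro smooth_on_add smooth_on_mult smooth_on_snd smooth_on_ident S(1) smt sm)
  have sm\<phi>: "smooth_on S \<phi>"
    unfolding \<phi>_def by (rule smooth_on_Pair[OF S(1) smt[OF sm(1)] smX])
  have T_less: "T s < T t" if st: "s \<in> fst ` S" "t \<in> fst ` S" "s < t" for s t
  proof (rule DERIV_pos_imp_increasing[OF st(3)])
    fix r assume r: "s \<le> r" "r \<le> t"
    have "closed_segment s t \<subseteq> fst ` S"
      by (rule closed_segment_subset[OF st(1,2) I(2)])
    moreover have "r \<in> closed_segment s t"
      using r by (simp add: closed_segment_eq_real_ivl)
    ultimately have rI: "r \<in> fst ` S" by (rule subsetD)
    show "\<exists>y. (T has_real_derivative y) (at r) \<and> 0 < y"
      using smooth_on_deriv(1)[OF I(1) sm(1) rI] T'[OF rI] nz[OF rI] by auto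
  qed
  have inj: "inj_on \<phi> S"
  proof (rule inj_onI)
    fix p p' assume p: "p \<in> S" "p' \<in> S" and eq: "\<phi> p = \<phi> p'"
    have "fst p = fst p'"
      using T_less[of "fst p" "fst p'"] T_less[of "fst p'" "fst p"] p eq
      by (cases "fst p" "fst p'" rule: linorder_cases) (auto simp: \<phi>_def)
    then show "p = p'"
      using eq nz[of "fst p"] p by (auto simp: \<phi>_def prod_eq_iff)
  qed
  define c where "c p = 1 / X1 (fst p) * (B p - 2 * \<epsilon> * (pd_x U1 p / U1 p))
      - (deriv X1 (fst p) * snd p + deriv X0 (fst p)) / (X1 (fst p))\<^sup>2" for p
  have smc: "smooth_on S c"
    unfolding c_def
    by (intro smooth_on_diff smooth_on_mult smooth_on_divide smooth_on_add smooth_on_power smooth_on_const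
        smooth_on_snd smooth_on_ident S(1) smt sm smooth_on_deriv(2) I(1) smooth_on_pd(2) B[folded S_def])
      (use nz nzU in auto)
  define B' where "B' y = c (inv_into S \<phi> y)" for y
  have B'\<phi>: "B' (\<phi> p) = c p" if "p \<in> S" for p
    using inv_into_f_f[OF inj that] by (simp add: B'_def)
  have "fst (\<Phi> z) = \<phi> (fst z)" if "z \<in> Q" for z
    using \<Phi>[of "fst (fst z)" "snd (fst z)" "snd z"] that by (simp add: \<phi>_def)
  then have image: "fst ` \<Phi> ` Q = \<phi> ` S"
    unfolding S_def image_image by simp
  have "smooth_on (\<phi> ` S) B'"
  proof (rule smooth_on_local)
    fix y assume "y \<in> \<phi> ` S"
    then obtain p where p: "p \<in> S" "y = \<phi> p" by blast
    obtain t x where tx: "p = (t, x)" by (cases p)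
    have tI: "t \<in> fst ` S" using p(1) tx by force
    have D: "frechet_derivative \<phi> (at p) = (\<lambda>v. (frechet_derivative (\<lambda>p. T (fst p)) (at p) v,
        frechet_derivative (\<lambda>p. X1 (fst p) * snd p + X0 (fst p)) (at p) v))"
      unfolding \<phi>_def[abs_def]
      by (rule frechet_derivative_at[OF has_derivative_Pair[OF smooth_on_has_derivative[OF smt[OF sm(1)] p(1)]
          smooth_on_has_derivative[OF smX p(1)]], symmetric])
    have "pd_t (\<lambda>p. T (fst p)) p = (X1 t)\<^sup>2" "pd_x (\<lambda>p. T (fst p)) p = 0"
      using T'[OF tI] by (simp_all add: pd_t_def pd_x_def tx)
    moreover have "pd_x (\<lambda>p. X1 (fst p) * snd p + X0 (fst p)) p = X1 t"
      unfolding pd_x_def tx by (rule DERIV_imp_deriv) (auto intro!: derivative_eq_intros)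
    ultimately have J: "fst (frechet_derivative \<phi> (at p) (1, 0)) * snd (frechet_derivative \<phi> (at p) (0, 1)) -
        fst (frechet_derivative \<phi> (at p) (0, 1)) * snd (frechet_derivative \<phi> (at p) (1, 0)) \<noteq> 0"
      using nz[OF tI]
      by (simp add: D smooth_on_pd_eq[OF smt[OF sm(1)] p(1), symmetric] smooth_on_pd_eq[OF smX p(1), symmetric])
    obtain N G where N: "open N" "p \<in> N" "N \<subseteq> S" "open (\<phi> ` N)" "smooth_on (\<phi> ` N) G"
      "\<And>p. p \<in> N \<Longrightarrow> G (\<phi> p) = p"
      by (rule smooth_inverse_plane[OF S(1) sm\<phi> p(1) J]) blast
    have "smooth_on (\<phi> ` N) (\<lambda>y. c (G y))"
      by (rule smooth_on_compose[OF smc N(4,5)]) (use N(3,6) in auto)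
    moreover have "B' y = c (G y)" if "y \<in> \<phi> ` N" for y
      using that N(3,6) B'\<phi> by auto
    ultimately have "smooth_on (\<phi> ` N) B'"
      using smooth_on_cong[OF N(4), of B' "\<lambda>y. c (G y)"] by blast
    then show "\<exists>M. open M \<and> y \<in> M \<and> smooth_on M B'"
      using N(2,4) p(2) by blast
  qed
  then have "smooth_on (fst ` \<Phi> ` Q) B'" by (simp only: image)
  then show ?thesis
  proof (rule that)
    fix t x assume "(t, x) \<in> fst ` Q"
    then have "(t, x) \<in> S" by (simp only: S_def)
    from B'\<phi>[OF this]
    show "B' (T t, X1 t * x + X0 t) =
      1 / X1 t * (B (t, x) - 2 * \<epsilon> * (pd_x U1 (t, x) / U1 (t, x)))
      - (deriv X1 t * x + deriv X0 t) / (X1 t)\<^sup>2"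
      by (simp add: \<phi>_def c_def)
  qed
qed

text \<open>On a general \<Omega> different component functions may occur over different pieces of a
  fibre, hence the quantification over convex Q. The first half characterises a given target drift.
  The second expresses that the parameters are arbitrary: any components of this form have a target.
  It is posed on Q because on \<Omega> distinct base points may share an image while prescribing
  different drift values there.\<close>

theorem proposition25:
  fixes \<epsilon> :: real and \<Omega> :: "total set" and \<Phi> :: "total \<Rightarrow> total" and B :: "base \<Rightarrow> real"
  assumes "\<epsilon> \<in> {-1, 1}"
    and "point_transformation \<Omega> \<Phi>"
    and "smooth_on (fst ` \<Omega>) B"
  shows "(\<forall>B'. smooth_on (fst ` \<Phi> ` \<Omega>) B' \<longrightarrow>
      (connects \<epsilon> \<Omega> \<Phi> B B' \<longleftrightarrow>
       (\<forall>Q. open Q \<and> convex Q \<and> Q \<subseteq> \<Omega> \<longrightarrow>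
          (\<exists>T X0 X1 U0 U1. has_components \<epsilon> B Q \<Phi> T X0 X1 U0 U1 \<and>
             (\<forall>t x. (t, x) \<in> fst ` Q \<longrightarrow>
                B' (T t, X1 t * x + X0 t) =
                  1 / X1 t * (B (t, x) - 2 * \<epsilon> * (pd_x U1 (t, x) / U1 (t, x)))
                  - (deriv X1 t * x + deriv X0 t) / (X1 t)\<^sup>2))))) \<and>
    (\<forall>Q. open Q \<and> convex Q \<and> Q \<subseteq> \<Omega> \<longrightarrow>
      ((\<exists>B'. smooth_on (fst ` \<Phi> ` Q) B' \<and> connects \<epsilon> Q \<Phi> B B') \<longleftrightarrow>
       (\<exists>T X0 X1 U0 U1. has_components \<epsilon> B Q \<Phi> T X0 X1 U0 U1)))"
proof (intro conjI allI impI iffI)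
  fix B' Q
  assume "connects \<epsilon> \<Omega> \<Phi> B B'" "open Q \<and> convex Q \<and> Q \<subseteq> \<Omega>"
  then show "\<exists>T X0 X1 U0 U1. has_components \<epsilon> B Q \<Phi> T X0 X1 U0 U1 \<and>
      (\<forall>t x. (t, x) \<in> fst ` Q \<longrightarrow> B' (T t, X1 t * x + X0 t) =
        1 / X1 t * (B (t, x) - 2 * \<epsilon> * (pd_x U1 (t, x) / U1 (t, x)))
        - (deriv X1 t * x + deriv X0 t) / (X1 t)\<^sup>2)"
    using connects_normal_form[OF assms(1,2)] by blast
next
  fix B'
  assume local_form: "\<forall>Q. open Q \<and> convex Q \<and> Q \<subseteq> \<Omega> \<longrightarrow>
      (\<exists>T X0 X1 U0 U1. has_components \<epsilon> B Q \<Phi> T X0 X1 U0 U1 \<and>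
        (\<forall>t x. (t, x) \<in> fst ` Q \<longrightarrow> B' (T t, X1 t * x + X0 t) =
          1 / X1 t * (B (t, x) - 2 * \<epsilon> * (pd_x U1 (t, x) / U1 (t, x)))
          - (deriv X1 t * x + deriv X0 t) / (X1 t)\<^sup>2))"
  show "connects \<epsilon> \<Omega> \<Phi> B B'"
  proof (rule connectsI)
    fix N p f V q g
    assume pair: "open N" "p \<in> N" "smooth_on N f" "graph_on N f \<subseteq> \<Omega>" "open V" "smooth_on V g"
      "\<Phi> ` graph_on N f = graph_on V g" "\<Phi> (p, f p) = (q, g q)"
    have "(p, f p) \<in> \<Omega>" using pair(2,4) by (auto simp: graph_on_def)
    \<comment> \<open>The claim concerns jets at one point, so a ball around (p, f p) is a
      sufficient convex Q.\<close>
    then obtain d where d: "d > 0" "ball (p, f p) d \<subseteq> \<Omega>"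
      using point_transformation_smooth(1)[OF assms(2)] by (auto simp: open_contains_ball)
    obtain T X0 X1 U0 U1 where comp: "has_components \<epsilon> B (ball (p, f p) d) \<Phi> T X0 X1 U0 U1"
      and B': "\<And>t x. (t, x) \<in> fst ` ball (p, f p) d \<Longrightarrow> B' (T t, X1 t * x + X0 t) =
          1 / X1 t * (B (t, x) - 2 * \<epsilon> * (pd_x U1 (t, x) / U1 (t, x)))
          - (deriv X1 t * x + deriv X0 t) / (X1 t)\<^sup>2"
      using local_form d(2) by (meson convex_ball open_ball)
    show "jet2 f p \<in> kolmogorov \<epsilon> B \<longleftrightarrow> jet2 g q \<in> kolmogorov \<epsilon> B'"
      by (rule has_components_equation_iff[OF comp open_ball B' pair(1-3,5-8)]) (use d(1) in simp_all)
  qed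
next
  fix Q
  assume Q: "open Q \<and> convex Q \<and> Q \<subseteq> \<Omega>"
    and "\<exists>B'. smooth_on (fst ` \<Phi> ` Q) B' \<and> connects \<epsilon> Q \<Phi> B B'"
  then obtain B' where "connects \<epsilon> Q \<Phi> B B'" by (elim exE conjE)
  from connects_normal_form[OF assms(1,2) this _ _ _ subset_refl] Q
  have "\<exists>T X0 X1 U0 U1. has_components \<epsilon> B Q \<Phi> T X0 X1 U0 U1 \<and>
      (\<forall>t x. (t, x) \<in> fst ` Q \<longrightarrow> B' (T t, X1 t * x + X0 t) =
        1 / X1 t * (B (t, x) - 2 * \<epsilon> * (pd_x U1 (t, x) / U1 (t, x)))
        - (deriv X1 t * x + deriv X0 t) / (X1 t)\<^sup>2)"
    by simp
  then show "\<exists>T X0 X1 U0 U1. has_components \<epsilon> B Q \<Phi> T X0 X1 U0 U1"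
    by (elim exE conjE) (intro exI)
next
  fix Q
  assume Q: "open Q \<and> convex Q \<and> Q \<subseteq> \<Omega>"
    and "\<exists>T X0 X1 U0 U1. has_components \<epsilon> B Q \<Phi> T X0 X1 U0 U1"
  then obtain T X0 X1 U0 U1 where comp: "has_components \<epsilon> B Q \<Phi> T X0 X1 U0 U1" by blast
  have oc: "open Q" "convex Q" and smB: "smooth_on (fst ` Q) B"
    using Q smooth_on_subset[OF assms(3) image_mono] by auto
  obtain B' where smB': "smooth_on (fst ` \<Phi> ` Q) B'"
    and B': "\<And>t x. (t, x) \<in> fst ` Q \<Longrightarrow> B' (T t, X1 t * x + X0 t) =
      1 / X1 t * (B (t, x) - 2 * \<epsilon> * (pd_x U1 (t, x) / U1 (t, x)))
      - (deriv X1 t * x + deriv X0 t) / (X1 t)\<^sup>2"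
    by (rule target_drift_exists[OF comp oc smB]) (rule that, assumption, blast)
  have "connects \<epsilon> Q \<Phi> B B'"
  proof (rule connectsI)
    fix N p f V q g
    assume pair: "open N" "p \<in> N" "smooth_on N f" "graph_on N f \<subseteq> Q" "open V" "smooth_on V g"
      "\<Phi> ` graph_on N f = graph_on V g" "\<Phi> (p, f p) = (q, g q)"
    have z: "(p, f p) \<in> Q" using pair(2,4) by (auto simp: graph_on_def)
    show "jet2 f p \<in> kolmogorov \<epsilon> B \<longleftrightarrow> jet2 g q \<in> kolmogorov \<epsilon> B'"
      by (rule has_components_equation_iff[OF comp oc(1) B' pair(1-3,5-8) z])
  qed
  with smB' show "\<exists>B'. smooth_on (fst ` \<Phi> ` Q) B' \<and> connects \<epsilon> Q \<Phi> B B'" by blast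
qed

end
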